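(* Suppose that a group $G$ admits a convergence action on a compact metrizable space $M$, let $d$ be a compatible metric on $M$ and let $d_u$ be the corresponding orbit uniform metric. Then the set of conical points and bounded parabolic points is $d_u$-dense in $\Lambda G$, i.e. dense in the metric space $(\Lambda G,d_u)$.
   Context: An action of a group $G$ by homeomorphisms on a compact Hausdorff space $M$ is a convergence action if for every sequence $\{g_n\}$ of distinct elements of $G$ there are a subsequence $\{g_{n_i}\}$ and points $a,b\in M$ such that $g_{n_i}x\to b$ locally uniformly on $M\setminus\{a\}$. A sequence $\{g_n\}$ in $G$ with $g_nx\to b$ locally uniformly on $M\setminus\{a\}$ is called a convergence sequence with attracting point $b$ and repelling point $a$. The limit set $\Lambda H$ of a subgroup $H\le G$ is the set of attracting points of convergence sequences in $H$. A point $\xi\in M$ is conical if there is a convergence sequence $\{g_n\}$ with attracting point $b\in M$ and repelling point $\xi$ such that $\{g_n\xi\}$ converges to a point different from $b$. A point $\xi\in M$ is parabolic if its stabilizer $G_\xi$ is infinite and $\Lambda G_\xi=\{\xi\}$; a parabolic point $\xi$ is bounded parabolic if the action of $G_\xi$ on $M\setminus\{\xi\}$ is cocompact. A compatible metric is one inducing the topology of $M$. Given a compatible metric $d$, the orbit uniform metric is $d_u(\xi,\eta)=\sup_{g\in G}d(g\xi,g\eta)$.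
   Formalization: Bounded parabolic is taken as cocompactness of G_ξ on ΛG∖{ξ}, not M∖{ξ} (with M∖{ξ} the claim fails for Z translating the Riemann sphere; both agree if ΛG=M), and convergence sequences consist of distinct elements (matters only if M has at most two points). *)

theory Defs
  imports "HOL-Analysis.Analysis" "HOL-Algebra.Group_Action"
begin

text \<open>The space $M$ is a whole type \<open>'m\<close> of class \<open>metric_space\<close> with \<open>compact UNIV\<close>. The class
  provides metrizability; its \<open>dist\<close> enters the dynamical notions only through the uniformity
  used in \<open>uniform_limit\<close>, and a compact Hausdorff space has only one compatible uniformity. The
  compatible metric of the orbit uniform metric is a separate parameter.\<close>

definition locally_uniform_limit_on ::
    "'m::metric_space set \<Rightarrow> (nat \<Rightarrow> 'm \<Rightarrow> 'm) \<Rightarrow> ('m \<Rightarrow> 'm) \<Rightarrow> bool"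
  where "locally_uniform_limit_on X f l \<longleftrightarrow>
    (\<forall>x\<in>X. \<exists>U. open U \<and> x \<in> U \<and> uniform_limit (U \<inter> X) f l sequentially)"

text \<open>Members of a convergence sequence are required to be distinct, as in the sequences of the
  convergence property. This only matters if $M$ has at most two points, where a constant sequence
  would otherwise qualify (for a one-point $M$ even the trivial group would have a limit point).\<close>

definition convergence_sequence ::
    "('g \<Rightarrow> 'm::metric_space \<Rightarrow> 'm) \<Rightarrow> 'g set \<Rightarrow> (nat \<Rightarrow> 'g) \<Rightarrow> 'm \<Rightarrow> 'm \<Rightarrow> bool"
  where "convergence_sequence \<phi> H g rep att \<longleftrightarrow>
    inj g \<and> range g \<subseteq> H \<and> locally_uniform_limit_on (- {rep}) (\<lambda>n. \<phi> (g n)) (\<lambda>_. att)"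

locale convergence_action = group_action G UNIV \<phi>
  for G :: "('g, 'r) monoid_scheme" (structure) and \<phi> :: "'g \<Rightarrow> 'm::metric_space \<Rightarrow> 'm" +
  assumes compact_space: "compact (UNIV :: 'm::metric_space set)"
    and homeomorphisms: "g \<in> carrier G \<Longrightarrow> homeomorphism UNIV UNIV (\<phi> g) (\<phi> (inv g))"
    and convergence: "\<lbrakk>inj s; range s \<subseteq> carrier G\<rbrakk> \<Longrightarrow>
      \<exists>r a b. strict_mono (r :: nat \<Rightarrow> nat) \<and> convergence_sequence \<phi> (carrier G) (s \<circ> r) a b"

definition limit_set :: "('g \<Rightarrow> 'm::metric_space \<Rightarrow> 'm) \<Rightarrow> 'g set \<Rightarrow> 'm set"
  where "limit_set \<phi> H = {b. \<exists>g a. convergence_sequence \<phi> H g a b}"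

definition conical :: "('g, 'r) monoid_scheme \<Rightarrow> ('g \<Rightarrow> 'm::metric_space \<Rightarrow> 'm) \<Rightarrow> 'm \<Rightarrow> bool"
  where "conical G \<phi> \<xi> \<longleftrightarrow> (\<exists>g b c. convergence_sequence \<phi> (carrier G) g \<xi> b \<and>
    (\<lambda>n. \<phi> (g n) \<xi>) \<longlonglongrightarrow> c \<and> c \<noteq> b)"

definition parabolic :: "('g, 'r) monoid_scheme \<Rightarrow> ('g \<Rightarrow> 'm::metric_space \<Rightarrow> 'm) \<Rightarrow> 'm \<Rightarrow> bool"
  where "parabolic G \<phi> \<xi> \<longleftrightarrow>
    infinite (stabilizer G \<phi> \<xi>) \<and> limit_set \<phi> (stabilizer G \<phi> \<xi>) = {\<xi>}"

definition cocompact_on :: "('g \<Rightarrow> 'm::metric_space \<Rightarrow> 'm) \<Rightarrow> 'g set \<Rightarrow> 'm set \<Rightarrow> bool"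
  where "cocompact_on \<phi> H X \<longleftrightarrow> (\<exists>K. compact K \<and> K \<subseteq> X \<and> (\<Union>h\<in>H. \<phi> h ` K) = X)"

text \<open>Bounded parabolicity refers to the action on $\Lambda G$, i.e. to cocompactness on
  $\Lambda G - \{\xi\}$. For $\Lambda G = M$ this is cocompactness on $M - \{\xi\}$ (see
  \<open>bounded_parabolic_minimal\<close>). If $\Lambda G \neq M$, the latter condition is too strong for the
  density theorem: for the integers acting on the Riemann sphere by the translations
  $z \mapsto z + n$, the only limit point is $\infty$; it is not conical, and the action on
  the plane is not cocompact.\<close>

definition bounded_parabolic ::
    "('g, 'r) monoid_scheme \<Rightarrow> ('g \<Rightarrow> 'm::metric_space \<Rightarrow> 'm) \<Rightarrow> 'm \<Rightarrow> bool"
  where "bounded_parabolic G \<phi> \<xi> \<longleftrightarrow> parabolic G \<phi> \<xi> \<and>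
    cocompact_on \<phi> (stabilizer G \<phi> \<xi>) (limit_set \<phi> (carrier G) - {\<xi>})"

lemma bounded_parabolic_minimal:
  assumes "limit_set \<phi> (carrier G) = UNIV"
  shows "bounded_parabolic G \<phi> \<xi> \<longleftrightarrow>
    parabolic G \<phi> \<xi> \<and> cocompact_on \<phi> (stabilizer G \<phi> \<xi>) (UNIV - {\<xi>})"
  using assms by (simp add: bounded_parabolic_def)

definition compatible_metric :: "('m::topological_space \<Rightarrow> 'm \<Rightarrow> real) \<Rightarrow> bool"
  where "compatible_metric d \<longleftrightarrow>
    Metric_space UNIV d \<and> Metric_space.mtopology UNIV d = euclidean"

definition orbit_uniform_metric ::
    "('g, 'r) monoid_scheme \<Rightarrow> ('g \<Rightarrow> 'm \<Rightarrow> 'm) \<Rightarrow> ('m \<Rightarrow> 'm \<Rightarrow> real) \<Rightarrow> 'm \<Rightarrow> 'm \<Rightarrow> real"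
  where "orbit_uniform_metric G \<phi> d \<xi> \<eta> = (SUP g\<in>carrier G. d (\<phi> g \<xi>) (\<phi> g \<eta>))"

text \<open>The real-valued supremum above is over a bounded nonempty set, and it defines a metric.\<close>

lemma compatible_metric_bounded:
  assumes "compact (UNIV :: 'm::metric_space set)" "compatible_metric (d :: 'm \<Rightarrow> 'm \<Rightarrow> real)"
  obtains B where "\<And>x y. d x y \<le> B"
proof -
  interpret Metric_space UNIV d
    using assms(2) by (simp add: compatible_metric_def)
  have "compactin mtopology UNIV"
    using assms by (simp add: compatible_metric_def)
  then have "mbounded UNIV"
    by (rule compactin_imp_mbounded)
  then show ?thesis
    using that by (auto simp: mbounded_alt)
qed

lemma (in convergence_action) Metric_space_orbit_uniform_metric:
  assumes "compatible_metric d"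
  shows "Metric_space S (orbit_uniform_metric G \<phi> d)"
proof -
  interpret d: Metric_space UNIV d
    using assms by (simp add: compatible_metric_def)
  obtain B where B: "\<And>x y. d x y \<le> B"
    using compatible_metric_bounded[OF compact_space assms] by blast
  interpret group_hom G "BijGroup UNIV" \<phi> by (rule group_hom)
  have one: "\<one> \<in> carrier G" by simp
  have id: "\<phi> \<one> x = x" for x
    using id_eq_one by (metis UNIV_I restrict_apply')
  have bdd: "bdd_above ((\<lambda>g. d (\<phi> g x) (\<phi> g y)) ` carrier G)" for x y
    by (rule bdd_aboveI2[of _ _ B]) (rule B)
  have ge: "d (\<phi> g x) (\<phi> g y) \<le> orbit_uniform_metric G \<phi> d x y" if "g \<in> carrier G" for g x y
    unfolding orbit_uniform_metric_def using that bdd by (rule cSUP_upper)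
  have ge': "d x y \<le> orbit_uniform_metric G \<phi> d x y" for x y
    using ge[OF one, of x y] by (simp only: id)
  show ?thesis
  proof
    show "0 \<le> orbit_uniform_metric G \<phi> d x y" for x y
      using ge'[of x y] d.nonneg[of x y] by linarith
    show "orbit_uniform_metric G \<phi> d x y = orbit_uniform_metric G \<phi> d y x" for x y
      by (simp add: orbit_uniform_metric_def d.commute)
    show "orbit_uniform_metric G \<phi> d x y = 0 \<longleftrightarrow> x = y" for x y
    proof
      assume "orbit_uniform_metric G \<phi> d x y = 0"
      then show "x = y" using ge'[of x y] d.nonneg[of x y] d.zero[of x y] by simp
    next
      assume "x = y"
      moreover have "carrier G \<noteq> {}" using one by blast
      ultimately show "orbit_uniform_metric G \<phi> d x y = 0"
        by (simp add: orbit_uniform_metric_def)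
    qed
    show "orbit_uniform_metric G \<phi> d x z
        \<le> orbit_uniform_metric G \<phi> d x y + orbit_uniform_metric G \<phi> d y z" for x y z
      unfolding orbit_uniform_metric_def[of G \<phi> d x z]
    proof (rule cSUP_least)
      show "carrier G \<noteq> {}" using one by blast
      fix g assume "g \<in> carrier G"
      then show "d (\<phi> g x) (\<phi> g z)
          \<le> orbit_uniform_metric G \<phi> d x y + orbit_uniform_metric G \<phi> d y z"
        using ge[of g x y] ge[of g y z] d.triangle[of "\<phi> g x" "\<phi> g y" "\<phi> g z"] by simp
    qed
  qed
qed

end

theory Submission
  imports Defs
begin

text \<open>Write $Q_\epsilon(\xi)$ for the set of $q \in G$ that move $\xi$ by at most $\epsilon$ in the
  orbit uniform metric. Suppose that no point of $\Lambda G$ within $\epsilon$ of $\xi$ is conical.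

  Seen from a nonconical point $\eta$, the sets $\{z : d(g\eta, gz) \ge \epsilon/4\}$, $g \in G$,
  shrink to points, so those that are maximal under inclusion exist. The corresponding points
  $g\eta$ lie in finitely many $\epsilon$-balls of the orbit uniform metric: two such points
  that are close in $d$ but separated by some $h \in G$ would give a strictly larger set, the one of
  $hg$. This yields two facts. If $\eta$ is isolated in the orbit uniform metric, then its
  stabilizer acts cocompactly on $\Lambda G - \{\eta\}$. If $Q_\epsilon(\eta)$ is finite, then a
  neighbourhood of $\eta$ is contained in an $\epsilon$-ball of the orbit uniform metric,
  although conical points (fixed points of loxodromic elements) accumulate at $\eta$; so
  $Q_\epsilon(\eta)$ is infinite near $\xi$.

  If a convergence sequence in $Q_\epsilon(\eta)$ has distinct attracting and repelling points, its
  members are eventually loxodromic, and some of their fixed points, which are conical, lie within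
  $3\epsilon$ of $\eta$ in the orbit uniform metric. Near $\xi$ this is impossible, and applied to products
  of two sequences it shows that all convergence sequences in $Q_\epsilon(\eta)$ have the same
  attracting point $p$. As $\epsilon \to 0$ this gives $p = \eta$, but $p$ does not
  change if $\eta$ is moved slightly. So $\xi$ is isolated, hence bounded parabolic.\<close>

section \<open>Sequences\<close>

lemma subseq_constant_or_inj:
  fixes s :: "nat \<Rightarrow> 'a"
  obtains r where "strict_mono (r :: nat \<Rightarrow> nat)" "(\<forall>n. s (r n) = s (r 0)) \<or> inj (s \<circ> r)"
proof (cases "finite (range s)")
  case True
  then obtain v where inf: "infinite {n \<in> UNIV. s n = s v}"
    using pigeonhole_infinite[of UNIV s] by auto
  define r where "r = enumerate {n. s n = s v}"
  have "strict_mono r"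
    using inf unfolding r_def by (simp add: strict_mono_enumerate)
  moreover have "s (r n) = s v" for n
    using inf enumerate_in_set[of "{n. s n = s v}" n] unfolding r_def by simp
  ultimately show ?thesis using that[of r] by simp
next
  case False
  \<comment> \<open>Indices at which a value occurs for the first time: \<open>s\<close> is
    injective on \<open>I\<close> and has the same range there.\<close>
  define I where "I = {n. \<forall>m<n. s m \<noteq> s n}"
  have "s n \<in> s ` I" for n
  proof -
    have "(LEAST m. s m = s n) \<in> I"
      unfolding I_def using not_less_Least by (smt (verit, ccfv_SIG) LeastI mem_Collect_eq)
    moreover have "s (LEAST m. s m = s n) = s n"
      by (rule LeastI) simp
    ultimately show ?thesis by (metis imageI)
  qed
  then have "infinite I" using False finite_surj[of I "range s" s] by blast
  then have r: "strict_mono (enumerate I)" "\<And>n. enumerate I n \<in> I"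
    by (auto intro: strict_mono_enumerate enumerate_in_set)
  have "inj_on s I" unfolding I_def inj_on_def by (metis (mono_tags, lifting) linorder_neqE_nat mem_Collect_eq)
  then have "inj (s \<circ> enumerate I)"
    using r strict_mono_imp_inj_on[OF r(1)]
    by (intro comp_inj_on) (auto intro: inj_on_subset)
  then show ?thesis using r(1) that by blast
qed

text \<open>Recursive choice outside the finitely many earlier values. It serves a diagonal argument
  in which the chosen group elements must be distinct to form a convergence sequence.\<close>

lemma exists_inj_selection:
  fixes S :: "nat \<Rightarrow> 'a set"
  assumes "\<And>m. infinite (S m)"
  obtains f where "inj f" "\<And>m. f m \<in> S m"
proof -
  have "\<exists>f. \<forall>m::nat. f m \<in> S m \<and> f m \<notin> f ` {..<m}"
  proof (rule dependent_wellorder_choice)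
    show "\<exists>r. r \<in> S m \<and> r \<notin> f ` {..<m}" for f :: "nat \<Rightarrow> 'a" and m
      using assms[of m] by (meson finite_imageI finite_lessThan finite_subset subsetI)
  qed auto
  then obtain f where f: "\<And>m. f m \<in> S m" "\<And>m. f m \<notin> f ` {..<m}" by blast
  have "inj f"
  proof (rule linorder_injI)
    show "f x \<noteq> f y" if "x < y" for x y using f(2)[of y] that by (metis imageI lessThan_iff)
  qed
  with f(1) show ?thesis using that by blast
qed

text \<open>With \<open>R\<close> read as being far apart: a set without a finite net contains an
  infinite separated sequence.\<close>

lemma exists_pairwise_sequence:
  assumes "\<And>T. finite T \<Longrightarrow> T \<subseteq> F \<Longrightarrow> \<exists>f\<in>F. \<forall>k\<in>T. R k f"
  shows "\<exists>f :: nat \<Rightarrow> 'a. (\<forall>n. f n \<in> F) \<and> (\<forall>m n. m < n \<longrightarrow> R (f m) (f n))"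
proof -
  have "\<exists>f. \<forall>n::nat. f n \<in> F \<and> (\<forall>m<n. R (f m) (f n))"
  proof (rule dependent_wellorder_choice)
    fix n :: nat and f :: "nat \<Rightarrow> 'a"
    assume "\<And>y. y < n \<Longrightarrow> f y \<in> F \<and> (\<forall>m<y. R (f m) (f y))"
    then show "\<exists>r. r \<in> F \<and> (\<forall>m<n. R (f m) r)"
      using assms[of "f ` {..<n}"] by (auto simp: image_subset_iff)
  qed auto
  then show ?thesis by blast
qed

section \<open>Convergence sequences\<close>

text \<open>Symmetric in the two points up to contraposition, which makes inversion immediate.\<close>

lemma convergence_sequence_iff:
  assumes "compact (UNIV :: 'm::metric_space set)"
  shows "convergence_sequence \<phi> H g a (b :: 'm) \<longleftrightarrow> inj g \<and> range g \<subseteq> H \<and>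
    (\<forall>\<delta>>0. \<forall>\<kappa>>0. \<forall>\<^sub>F n in sequentially. \<forall>z. \<delta> \<le> dist z a \<longrightarrow> dist (\<phi> (g n) z) b < \<kappa>)"
    (is "_ \<longleftrightarrow> _ \<and> _ \<and> ?R")
proof -
  have "locally_uniform_limit_on (- {a}) (\<lambda>n. \<phi> (g n)) (\<lambda>_. b) \<longleftrightarrow> ?R"
  proof (intro iffI allI impI)
    fix \<delta> \<kappa> :: real
    assume L: "locally_uniform_limit_on (- {a}) (\<lambda>n. \<phi> (g n)) (\<lambda>_. b)" and "0 < \<delta>" "0 < \<kappa>"
    define K where "K = {z. \<delta> \<le> dist z a}"
    have "closed K" unfolding K_def
      by (intro closed_Collect_le continuous_intros)
    then have K: "compact K" using assms compact_Int_closed[of UNIV K] by simp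
    have "\<forall>x\<in>K. \<exists>U. open U \<and> x \<in> U \<and> uniform_limit (U \<inter> - {a}) (\<lambda>n. \<phi> (g n)) (\<lambda>_. b) sequentially"
      using L \<open>0 < \<delta>\<close> unfolding locally_uniform_limit_on_def K_def by auto
    then obtain U where U: "\<And>x. x \<in> K \<Longrightarrow> open (U x) \<and> x \<in> U x \<and>
        uniform_limit (U x \<inter> - {a}) (\<lambda>n. \<phi> (g n)) (\<lambda>_. b) sequentially"
      by metis
    then obtain D where D: "D \<subseteq> K" "finite D" "K \<subseteq> (\<Union>x\<in>D. U x)"
      using compactE_image[OF K, of K U] by (smt (verit) UN_I subsetI)
    have "\<forall>\<^sub>F n in sequentially. \<forall>x\<in>D. \<forall>z\<in>U x \<inter> - {a}. dist (\<phi> (g n) z) b < \<kappa>"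
      using D U \<open>0 < \<kappa>\<close> by (intro eventually_ball_finite) (auto dest!: uniform_limitD)
    then show "\<forall>\<^sub>F n in sequentially. \<forall>z. \<delta> \<le> dist z a \<longrightarrow> dist (\<phi> (g n) z) b < \<kappa>"
    proof eventually_elim
      case (elim n)
      then show ?case using D(3) \<open>0 < \<delta>\<close> unfolding K_def by fastforce
    qed
  next
    assume R: ?R
    show "locally_uniform_limit_on (- {a}) (\<lambda>n. \<phi> (g n)) (\<lambda>_. b)"
      unfolding locally_uniform_limit_on_def
    proof
      fix x assume "x \<in> - {a}"
      then have pos: "0 < dist x a / 2" by simp
      have "uniform_limit (ball x (dist x a / 2) \<inter> - {a}) (\<lambda>n. \<phi> (g n)) (\<lambda>_. b) sequentially"
      proof (rule uniform_limitI)
        fix e :: real assume "0 < e"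
        then have "\<forall>\<^sub>F n in sequentially. \<forall>z. dist x a / 2 \<le> dist z a \<longrightarrow> dist (\<phi> (g n) z) b < e"
          using R pos by blast
        then show "\<forall>\<^sub>F n in sequentially. \<forall>z\<in>ball x (dist x a / 2) \<inter> - {a}. dist (\<phi> (g n) z) b < e"
        proof eventually_elim
          case (elim n)
          have "dist x a / 2 \<le> dist z a" if "z \<in> ball x (dist x a / 2)" for z
            using that dist_triangle[of x a z] by simp
          with elim show ?case by blast
        qed
      qed
      then show "\<exists>U. open U \<and> x \<in> U \<and>
          uniform_limit (U \<inter> - {a}) (\<lambda>n. \<phi> (g n)) (\<lambda>_. b) sequentially"
        using pos by (meson centre_in_ball open_ball)
    qed
  qed
  then show ?thesis unfolding convergence_sequence_def by simp
qed

lemma tendsto_dist_less: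
  assumes "\<And>n. dist (x n) l < C / real (Suc n)"
  shows "x \<longlonglongrightarrow> l"
proof -
  have "(\<lambda>n. C / real (Suc n)) \<longlonglongrightarrow> 0"
    using LIMSEQ_Suc[OF lim_const_over_n[of C]] by simp
  from real_tendsto_sandwich[OF _ _ tendsto_const this, of "\<lambda>n. dist (x n) l"]
  show ?thesis using assms by (simp add: tendsto_dist_iff[of x] less_imp_le)
qed

text \<open>Pairs violating uniform continuity would have subsequences with a common limit, around
  which \<open>d\<close>-balls are open. This is the bridge from \<open>dist\<close>, in which the
  main argument runs, to the given metric \<open>d\<close>.\<close>

lemma compatible_metric_uniformly_continuous:
  assumes "compact (UNIV :: 'm::metric_space set)" "compatible_metric (d :: 'm \<Rightarrow> 'm \<Rightarrow> real)" "0 < e"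
  obtains \<delta> where "0 < \<delta>" "\<And>x y. dist x y < \<delta> \<Longrightarrow> d x y < e"
proof (rule ccontr)
  assume "\<not> thesis"
  have "\<exists>x y. dist x y < 1 / real (Suc n) \<and> e \<le> d x y" for n
  proof (rule ccontr)
    assume "\<not> ?thesis"
    then have "d x y < e" if "dist x y < 1 / real (Suc n)" for x y
      using that by (meson not_less)
    with \<open>\<not> thesis\<close> that[of "1 / real (Suc n)"] show False by simp
  qed
  then obtain x y where xy: "\<And>n. dist (x n) (y n) < 1 / real (Suc n)" "\<And>n. e \<le> d (x n) (y n)"
    by metis
  interpret d: Metric_space UNIV d
    using assms(2) by (simp add: compatible_metric_def)
  obtain r l where r: "strict_mono (r :: nat \<Rightarrow> nat)" "(x \<circ> r) \<longlonglongrightarrow> l"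
    using assms(1) unfolding compact_def by blast
  have "(\<lambda>n. dist (x n) (y n)) \<longlonglongrightarrow> 0"
    by (rule tendsto_dist_less[of _ _ 1]) (use xy(1) in simp)
  then have "(\<lambda>n. dist ((x \<circ> r) n) ((y \<circ> r) n)) \<longlonglongrightarrow> 0"
    using LIMSEQ_subseq_LIMSEQ[OF _ r(1)] by (fastforce simp: comp_def)
  moreover have "(\<lambda>n. dist ((x \<circ> r) n) l) \<longlonglongrightarrow> 0"
    using r(2) tendsto_dist_iff by blast
  ultimately have "(\<lambda>n. dist ((x \<circ> r) n) ((y \<circ> r) n) + dist ((x \<circ> r) n) l) \<longlonglongrightarrow> 0"
    using tendsto_add by fastforce
  from real_tendsto_sandwich[OF _ _ tendsto_const this, of "\<lambda>n. dist ((y \<circ> r) n) l"]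
  have ry: "(y \<circ> r) \<longlonglongrightarrow> l"
    by (simp add: dist_triangle3 tendsto_dist_iff[of "y \<circ> r"])
  have "d.mtopology = euclidean"
    using assms(2) unfolding compatible_metric_def by blast
  then have "open (d.mball l (e / 2))"
    using d.openin_mball[of l "e / 2"] by (simp only: open_openin)
  moreover have "l \<in> d.mball l (e / 2)" using assms(3) by simp
  ultimately have "\<forall>\<^sub>F n in sequentially. (x \<circ> r) n \<in> d.mball l (e / 2)"
    "\<forall>\<^sub>F n in sequentially. (y \<circ> r) n \<in> d.mball l (e / 2)"
    using r(2) ry topological_tendstoD by blast+
  then have "\<forall>\<^sub>F n in sequentially. (x \<circ> r) n \<in> d.mball l (e / 2) \<and> (y \<circ> r) n \<in> d.mball l (e / 2)"
    by (rule eventually_conj)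
  then obtain n where "d l (x (r n)) < e / 2" "d l (y (r n)) < e / 2"
    using eventually_happens'[OF sequentially_bot] by fastforce
  then show False
    using xy(2)[of "r n"] d.triangle'[of "x (r n)" l "y (r n)"] d.commute[of l "x (r n)"]
      d.commute[of l "y (r n)"] by simp
qed

section \<open>Calculus of convergence sequences in the group\<close>

context convergence_action
begin

abbreviation conv :: "(nat \<Rightarrow> 'g) \<Rightarrow> 'm \<Rightarrow> 'm \<Rightarrow> bool"
  where "conv \<equiv> convergence_sequence \<phi> (carrier G)"

lemmas conv_iff = convergence_sequence_iff[OF compact_space, of \<phi>]

sublocale group G
  using group_hom by (rule group_hom.axioms(1))

lemma act_one [simp]: "\<phi> \<one> x = x"
  using id_eq_one by (metis UNIV_I restrict_apply')

lemma act_mult: "\<lbrakk>g \<in> carrier G; h \<in> carrier G\<rbrakk> \<Longrightarrow> \<phi> (g \<otimes> h) x = \<phi> g (\<phi> h x)"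
  by (rule composition_rule) auto

lemma act_inv_left [simp]: "g \<in> carrier G \<Longrightarrow> \<phi> (inv g) (\<phi> g x) = x"
  by (rule orbit_sym_aux) auto

lemma act_inv_right [simp]: "g \<in> carrier G \<Longrightarrow> \<phi> g (\<phi> (inv g) x) = x"
  using act_inv_left[of "inv g" x] by simp

lemma act_eq_iff [simp]: "g \<in> carrier G \<Longrightarrow> \<phi> g x = \<phi> g y \<longleftrightarrow> x = y"
  by (metis act_inv_left)

lemma continuous_act: "g \<in> carrier G \<Longrightarrow> continuous_on UNIV (\<phi> g)"
  using homeomorphisms by (auto simp: homeomorphism_def)

lemma isCont_act: "g \<in> carrier G \<Longrightarrow> isCont (\<phi> g) x"
  using continuous_act continuous_on_eq_continuous_at by blast

lemma tendsto_act: "\<lbrakk>g \<in> carrier G; (f \<longlongrightarrow> l) F\<rbrakk> \<Longrightarrow> ((\<lambda>n. \<phi> g (f n)) \<longlongrightarrow> \<phi> g l) F"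
  using isCont_act isCont_tendsto_compose by blast

lemma conv_carrier: "conv g a b \<Longrightarrow> g n \<in> carrier G"
  unfolding convergence_sequence_def by auto

lemma conv_eventually:
  "\<lbrakk>conv g a b; 0 < \<delta>; 0 < \<kappa>\<rbrakk> \<Longrightarrow>
    \<forall>\<^sub>F n in sequentially. \<forall>z. \<delta> \<le> dist z a \<longrightarrow> dist (\<phi> (g n) z) b < \<kappa>"
  unfolding conv_iff by blast

lemma subconvergence:
  assumes "inj s" "\<And>n. s n \<in> carrier G"
  obtains r a b where "strict_mono (r :: nat \<Rightarrow> nat)" "conv (s \<circ> r) a b"
  using convergence[of s] assms by blast

lemma subconvergence_infinite:
  assumes "infinite A" "A \<subseteq> carrier G"
  obtains s a b where "conv s a b" "\<And>n. s n \<in> A"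
proof -
  obtain s :: "nat \<Rightarrow> 'g" where s: "inj s" "range s \<subseteq> A"
    using assms(1) infinite_countable_subset by blast
  then obtain r a b where "conv (s \<circ> r) a b" using subconvergence assms(2) by (metis range_subsetD subsetD)
  then show ?thesis using s that[of "s \<circ> r"] by (metis comp_apply range_subsetD)
qed

lemma conv_subseq:
  assumes "conv g a b" "strict_mono r"
  shows "conv (g \<circ> r) a b"
proof -
  have "inj (g \<circ> r)"
    using assms strict_mono_imp_inj_on[OF assms(2)] unfolding conv_iff
    by (meson inj_compose)
  moreover have "\<forall>\<^sub>F n in sequentially. \<forall>z. \<delta> \<le> dist z a \<longrightarrow> dist (\<phi> ((g \<circ> r) n) z) b < \<kappa>"
    if "0 < \<delta>" "0 < \<kappa>" for \<delta> \<kappa>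
    using eventually_subseq[OF assms(2) conv_eventually[OF assms(1) that]] by simp
  ultimately show ?thesis using assms(1) unfolding conv_iff by auto
qed

lemma conv_inv:
  assumes "conv g a b"
  shows "conv (\<lambda>n. inv (g n)) b a"
  unfolding conv_iff
proof (intro conjI allI impI)
  show "inj (\<lambda>n. inv (g n))"
    using assms conv_carrier[OF assms] unfolding conv_iff inj_def by (metis inv_inv)
  show "range (\<lambda>n. inv (g n)) \<subseteq> carrier G"
    using conv_carrier[OF assms] by auto
  fix \<delta> \<kappa> :: real assume "0 < \<delta>" "0 < \<kappa>"
  \<comment> \<open>\<open>\<delta>\<close> and \<open>\<kappa>\<close> trade places: the estimate
    for \<open>g n\<close> is read contrapositively at \<open>\<phi> (inv (g n)) z\<close>.\<close>
  then have "\<forall>\<^sub>F n in sequentially. \<forall>z. \<kappa> \<le> dist z a \<longrightarrow> dist (\<phi> (g n) z) b < \<delta>"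
    by (intro conv_eventually[OF assms])
  then show "\<forall>\<^sub>F n in sequentially. \<forall>z. \<delta> \<le> dist z b \<longrightarrow> dist (\<phi> (inv (g n)) z) a < \<kappa>"
  proof eventually_elim
    case (elim n)
    show ?case
      using elim[rule_format, of "\<phi> (inv (g n)) _"] conv_carrier[OF assms, of n]
      by (smt (verit) act_inv_right)
  qed
qed

lemma conv_mult_left:
  assumes "conv g a b" "k \<in> carrier G"
  shows "conv (\<lambda>n. k \<otimes> g n) a (\<phi> k b)"
  unfolding conv_iff
proof (intro conjI allI impI)
  show "inj (\<lambda>n. k \<otimes> g n)"
    using assms conv_carrier[OF assms(1)] unfolding conv_iff inj_def by simp
  show "range (\<lambda>n. k \<otimes> g n) \<subseteq> carrier G"
    using conv_carrier[OF assms(1)] assms(2) by auto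
  fix \<delta> \<kappa> :: real assume "0 < \<delta>" "0 < \<kappa>"
  obtain \<eta> where "0 < \<eta>" and \<eta>: "\<And>x. dist x b < \<eta> \<Longrightarrow> dist (\<phi> k x) (\<phi> k b) < \<kappa>"
    using isCont_act[OF assms(2), of b] \<open>0 < \<kappa>\<close> unfolding continuous_at_eps_delta by blast
  have "\<forall>\<^sub>F n in sequentially. \<forall>z. \<delta> \<le> dist z a \<longrightarrow> dist (\<phi> (g n) z) b < \<eta>"
    using \<open>0 < \<delta>\<close> \<open>0 < \<eta>\<close> by (intro conv_eventually[OF assms(1)])
  then show "\<forall>\<^sub>F n in sequentially. \<forall>z. \<delta> \<le> dist z a \<longrightarrow> dist (\<phi> (k \<otimes> g n) z) (\<phi> k b) < \<kappa>"
    by eventually_elim (simp add: act_mult \<eta> assms(2) conv_carrier[OF assms(1)])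
qed

text \<open>Convergence is uniform away from \<open>a\<close>, so the argument may vary with
  \<open>n\<close>. Later the arguments are orbit points or fixed points of varying
  elements.\<close>

lemma conv_tendsto_moving:
  assumes "conv g a b" "x \<longlonglongrightarrow> l" "l \<noteq> a"
  shows "(\<lambda>n. \<phi> (g n) (x n)) \<longlonglongrightarrow> b"
proof (rule tendstoI)
  fix e :: real assume "0 < e"
  have d: "0 < dist l a / 2" using assms(3) by simp
  have "\<forall>\<^sub>F n in sequentially. dist (x n) l < dist l a / 2"
    using assms(2) d by (rule tendstoD)
  with conv_eventually[OF assms(1) d \<open>0 < e\<close>]
  show "\<forall>\<^sub>F n in sequentially. dist (\<phi> (g n) (x n)) b < e"
  proof eventually_elim
    case (elim n)
    have "dist l a / 2 \<le> dist (x n) a"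
      using elim(2) dist_triangle[of l a "x n"] by (simp add: dist_commute)
    with elim(1) show ?case by blast
  qed
qed

lemma conv_tendsto:
  assumes "conv g a b" "x \<noteq> a"
  shows "(\<lambda>n. \<phi> (g n) x) \<longlonglongrightarrow> b"
  using conv_tendsto_moving[OF assms(1) tendsto_const assms(2)] .

lemma compact_subsequence:
  fixes x :: "nat \<Rightarrow> 'm"
  obtains r l where "strict_mono (r :: nat \<Rightarrow> nat)" "(x \<circ> r) \<longlonglongrightarrow> l"
  using compact_space unfolding compact_def by blast

text \<open>If the images of a repelling \<open>\<xi>\<close> clustered anywhere but at
  \<open>b\<close>, a subsequence would witness that \<open>\<xi>\<close> is conical. Thus a
  nonconical point follows every convergence sequence to its attracting point, even when it is the
  repelling point.\<close>

lemma nonconical_tendsto: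
  assumes "\<not> conical G \<phi> \<xi>" "conv g a b"
  shows "(\<lambda>n. \<phi> (g n) \<xi>) \<longlonglongrightarrow> b"
proof (cases "a = \<xi>")
  case True
  show ?thesis
  proof (rule ccontr)
    assume "\<not> ?thesis"
    then obtain e where e: "0 < e" "\<exists>\<^sub>F n in sequentially. e \<le> dist (\<phi> (g n) \<xi>) b"
      unfolding tendsto_iff by (auto simp: not_eventually not_less)
    then have "infinite {n. e \<le> dist (\<phi> (g n) \<xi>) b}"
      by (simp add: frequently_sequentially infinite_nat_iff_unbounded_le Bex_def)
    then obtain r where r: "strict_mono (r :: nat \<Rightarrow> nat)" "\<And>n. e \<le> dist (\<phi> (g (r n)) \<xi>) b"
      using infinite_enumerate by (metis mem_Collect_eq)
    obtain r' c where r': "strict_mono (r' :: nat \<Rightarrow> nat)"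
      "((\<lambda>n. \<phi> (g (r n)) \<xi>) \<circ> r') \<longlonglongrightarrow> c" by (rule compact_subsequence)
    have "(\<lambda>n. dist (((\<lambda>n. \<phi> (g (r n)) \<xi>) \<circ> r') n) b) \<longlonglongrightarrow> dist c b"
      using r'(2) by (intro tendsto_intros)
    then have "e \<le> dist c b"
      by (rule LIMSEQ_le_const) (use r(2) in auto)
    then have "c \<noteq> b" using e(1) by auto
    moreover have "conv ((g \<circ> r) \<circ> r') \<xi> b"
      using conv_subseq[OF conv_subseq[OF assms(2) r(1)] r'(1)] True by simp
    ultimately have "conical G \<phi> \<xi>" using r'(2) unfolding conical_def by (auto simp: comp_def)
    with assms(1) show False by simp
  qed
qed (use conv_tendsto[OF assms(2)] in auto)

lemma subseq_constant_or_conv: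
  assumes "\<And>n. s n \<in> carrier G"
  obtains (const) r where "strict_mono (r :: nat \<Rightarrow> nat)" "\<And>n. s (r n) = s (r 0)"
  | (convergent) r a b where "strict_mono r" "conv (s \<circ> r) a b"
proof -
  obtain r where r: "strict_mono (r :: nat \<Rightarrow> nat)" "(\<forall>n. s (r n) = s (r 0)) \<or> inj (s \<circ> r)"
    by (rule subseq_constant_or_inj)
  show ?thesis
  proof (cases "\<forall>n. s (r n) = s (r 0)")
    case True
    with r(1) show ?thesis by (intro const[of r]) auto
  next
    case False
    then obtain r' a b where "strict_mono r'" "conv ((s \<circ> r) \<circ> r') a b"
      using r(2) subconvergence[of "s \<circ> r"] assms by auto
    then show ?thesis using convergent[of "r \<circ> r'" a b] r(1) by (auto simp: comp_assoc strict_mono_o)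
  qed
qed

text \<open>If the repelling point were neither limit, both image sequences would tend to
  \<open>b\<close>, against \<open>sep\<close>. The assumption \<open>close\<close> excludes
  constant subsequences: one element separating all pairs would separate \<open>l\<close> and
  \<open>m\<close>.\<close>

lemma subconvergence_separated:
  assumes s: "\<And>n. s n \<in> carrier G" and x: "x \<longlonglongrightarrow> l" and y: "y \<longlonglongrightarrow> m"
    and "0 < \<kappa>" and sep: "\<And>n. \<kappa> \<le> dist (\<phi> (s n) (x n)) (\<phi> (s n) (y n))"
    and close: "\<And>g. g \<in> carrier G \<Longrightarrow> dist (\<phi> g l) (\<phi> g m) < \<kappa>"
  obtains r a b where "strict_mono (r :: nat \<Rightarrow> nat)" "conv (s \<circ> r) a b" "a = l \<or> a = m"
proof (cases rule: subseq_constant_or_conv[of s, OF s, case_names const convergent])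
  case (const r)
  define g where "g = s (r 0)"
  have g: "g \<in> carrier G" "\<And>n. s (r n) = g" using s const by (auto simp: g_def)
  have "(\<lambda>n. dist (\<phi> g ((x \<circ> r) n)) (\<phi> g ((y \<circ> r) n))) \<longlonglongrightarrow> dist (\<phi> g l) (\<phi> g m)"
    by (intro tendsto_intros tendsto_act g LIMSEQ_subseq_LIMSEQ x y const)
  then have "\<kappa> \<le> dist (\<phi> g l) (\<phi> g m)"
    by (rule LIMSEQ_le_const) (use sep[of "r _"] g(2) in auto)
  with close[OF g(1)] show ?thesis by simp
next
  case (convergent r a b)
  have "a = l \<or> a = m"
  proof (rule ccontr)
    assume "\<not> ?thesis"
    then have "(\<lambda>n. dist (\<phi> ((s \<circ> r) n) ((x \<circ> r) n)) (\<phi> ((s \<circ> r) n) ((y \<circ> r) n))) \<longlonglongrightarrow> dist b b"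
      using conv_tendsto_moving[OF convergent(2) LIMSEQ_subseq_LIMSEQ[OF x convergent(1)]]
        conv_tendsto_moving[OF convergent(2) LIMSEQ_subseq_LIMSEQ[OF y convergent(1)]]
      by (intro tendsto_dist) auto
    then have "\<kappa> \<le> dist b b"
      by (rule LIMSEQ_le_const) (use sep[of "r _"] in auto)
    with \<open>0 < \<kappa>\<close> show False by simp
  qed
  with convergent that show ?thesis by blast
qed

text \<open>If $M$ has two points, translating a convergence sequence so that it fixes $M$ pointwise
  shows that both points are conical.\<close>

lemma third_point:
  fixes a b :: 'm
  assumes "\<not> conical G \<phi> \<xi>" "conv g \<alpha> \<beta>" "a \<noteq> b"
  obtains z where "z \<noteq> a" "z \<noteq> b"
proof (rule ccontr)
  assume "\<not> thesis"
  then have "\<forall>z. z = a \<or> z = b" using that by blast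
  moreover define \<xi>' where "\<xi>' = (if \<xi> = a then b else a)"
  ultimately have \<xi>': "\<xi>' \<noteq> \<xi>" "z = \<xi> \<or> z = \<xi>'" for z
    using assms(3) by (auto split: if_splits)
  \<comment> \<open>With only two points, a distance below \<open>dist \<xi> \<xi>'\<close> means
    equality, so \<open>\<phi> (g n) \<xi>\<close> is eventually equal to
    \<open>\<beta>\<close>.\<close>
  have "\<forall>\<^sub>F n in sequentially. dist (\<phi> (g n) \<xi>) \<beta> < dist \<xi> \<xi>'"
    using nonconical_tendsto[OF assms(1,2)] \<xi>'(1) by (intro tendstoD) auto
  then obtain N where N: "\<And>n. N \<le> n \<Longrightarrow> dist (\<phi> (g n) \<xi>) \<beta> < dist \<xi> \<xi>'"
    unfolding eventually_sequentially by blast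
  have \<beta>: "\<phi> (g n) \<xi> = \<beta>" if "N \<le> n" for n
    using N[OF that] \<xi>'(2)[of "\<phi> (g n) \<xi>"] \<xi>'(2)[of \<beta>] by (auto simp: dist_commute)
  define s where "s = (\<lambda>n. inv (g N) \<otimes> g (n + N))"
  have g: "g n \<in> carrier G" for n by (rule conv_carrier[OF assms(2)])
  have inv_\<beta>: "\<phi> (inv (g N)) \<beta> = \<xi>" using \<beta>[of N] act_inv_left[OF g[of N], of \<xi>] by simp
  have "conv (g \<circ> (\<lambda>n. n + N)) \<alpha> \<beta>"
    by (rule conv_subseq[OF assms(2)]) (simp add: strict_mono_def)
  from conv_mult_left[OF this inv_closed[OF g[of N]]] have s: "conv s \<alpha> \<xi>"
    by (simp add: s_def inv_\<beta> comp_def)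
  have s\<xi>: "\<phi> (s n) \<xi> = \<xi>" for n
    unfolding s_def using g \<beta>[of "n + N"] inv_\<beta> by (simp add: act_mult)
  have s\<xi>': "\<phi> (s n) \<xi>' = \<xi>'" for n
    using \<xi>' s\<xi>[of n] conv_carrier[OF s] by (metis act_eq_iff)
  have "\<alpha> = \<xi>'"
  proof (rule ccontr)
    assume "\<alpha> \<noteq> \<xi>'"
    then have "(\<lambda>n. \<phi> (s n) \<xi>') \<longlonglongrightarrow> \<xi>" by (intro conv_tendsto[OF s]) simp
    then show False using \<xi>'(1) by (simp add: s\<xi>' LIMSEQ_const_iff)
  qed
  with conv_inv[OF s] have "conv (\<lambda>n. inv (s n)) \<xi> \<xi>'" by simp
  moreover have "\<phi> (inv (s n)) \<xi> = \<xi>" for n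
    using act_inv_left[OF conv_carrier[OF s], of n \<xi>] by (simp add: s\<xi>)
  ultimately have "conical G \<phi> \<xi>"
    unfolding conical_def using \<xi>'(1)
    by (intro exI[of _ "\<lambda>n. inv (s n)"] exI[of _ \<xi>'] exI[of _ \<xi>]) simp
  with assms(1) show False by simp
qed

section \<open>Loxodromic elements\<close>

text \<open>Since \<open>q\<close> sends everything outside a small ball around \<open>a\<close>
  into a small ball around \<open>b\<close>, so do its positive powers. A convergence subsequence of
  the powers has its attracting point \<open>c\<close> near \<open>b\<close> and its repelling point
  \<open>e\<close> near \<open>a\<close>. Both are fixed because \<open>q\<close> commutes with its
  powers. The inverse powers repel from \<open>c\<close> but fix it, so \<open>c\<close> is conical.
  The third point \<open>z\<close> shows that the powers are distinct.\<close>

lemma loxodromic: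
  assumes q: "q \<in> carrier G" and "0 < \<delta>" and ab: "3 * \<delta> \<le> dist a b"
    and z: "\<delta> < dist z a" "\<delta> < dist z b"
    and contr: "\<And>x. \<delta> \<le> dist x a \<Longrightarrow> dist (\<phi> q x) b < \<delta>"
  obtains c e where "dist c b \<le> \<delta>" "dist e a \<le> \<delta>" "conical G \<phi> c" "\<phi> q c = c" "\<phi> q e = e"
    "\<And>\<rho>. 0 < \<rho> \<Longrightarrow> \<exists>k::nat. dist (\<phi> (q [^] k) z) c < \<rho>"
proof -
  \<comment> \<open>\<open>Suc\<close> omits the zeroth power, which contracts nothing.\<close>
  define s where "s = (\<lambda>k::nat. q [^] Suc k)"
  have sG: "s k \<in> carrier G" for k unfolding s_def using q by blast
  have qs: "q \<otimes> s k = s k \<otimes> q" for k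
    unfolding s_def using q by (metis nat_pow_Suc nat_pow_Suc2)
  have s_Suc: "s (Suc k) = q \<otimes> s k" for k
    unfolding s_def using q by (metis nat_pow_Suc2)
  have far: "\<delta> \<le> dist x a" if "dist x b < \<delta>" for x
    using that ab \<open>0 < \<delta>\<close> dist_triangle3[of a b x] by simp
  have s: "dist (\<phi> (s k) x) b < \<delta>" if "\<delta> \<le> dist x a" for k x
  proof (induction k)
    case 0
    then show ?case using contr[OF that] q by (simp add: s_def)
  next
    case (Suc k)
    then show ?case using contr far sG q by (simp add: s_Suc act_mult)
  qed
  have s_inv: "dist (\<phi> (inv (s k)) x) a < \<delta>" if "\<delta> \<le> dist x b" for k x
    using s[of "\<phi> (inv (s k)) x" k] sG[of k] that by fastforce
  have "inj s"
  proof (rule linorder_injI)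
    fix j k :: nat assume "j < k"
    show "s j \<noteq> s k"
    proof
      assume eq: "s j = s k"
      have "s k = s j \<otimes> s (k - Suc j)"
        unfolding s_def using \<open>j < k\<close> q by (subst nat_pow_mult) auto
      then have "s (k - Suc j) = \<one>"
        using eq l_cancel_one'[OF sG[of j] sG[of "k - Suc j"]] by simp
      then have "dist z b < \<delta>" using s[of z "k - Suc j"] z by simp
      with z show False by simp
    qed
  qed
  then obtain r e c where r: "strict_mono r" and conv: "conv (s \<circ> r) e c"
    using sG subconvergence by blast
  have conv': "conv (\<lambda>n. inv ((s \<circ> r) n)) c e" by (rule conv_inv[OF conv])
  have "z \<noteq> a" "z \<noteq> b" using z \<open>0 < \<delta>\<close> by auto
  have c: "dist c b \<le> \<delta>"
  proof -
    \<comment> \<open>The distinct points \<open>b\<close> and \<open>z\<close> both lie outside the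
      ball around \<open>a\<close>; at least one of them is not \<open>e\<close>.\<close>
    obtain x where x: "x \<noteq> e" "\<delta> \<le> dist x a"
      using far[of b] \<open>0 < \<delta>\<close> z \<open>z \<noteq> b\<close> by (metis dist_self less_imp_le)
    have "(\<lambda>n. dist (\<phi> ((s \<circ> r) n) x) b) \<longlonglongrightarrow> dist c b"
      by (intro tendsto_intros conv_tendsto[OF conv x(1)])
    then show ?thesis by (rule LIMSEQ_le_const2) (use s[OF x(2)] less_imp_le in auto)
  qed
  have ba: "\<delta> \<le> dist a b" using ab \<open>0 < \<delta>\<close> by simp
  have e: "dist e a \<le> \<delta>"
  proof -
    obtain x where x: "x \<noteq> c" "\<delta> \<le> dist x b"
      using ba z \<open>z \<noteq> a\<close> by (metis less_imp_le)
    have "(\<lambda>n. dist (\<phi> (inv ((s \<circ> r) n)) x) a) \<longlonglongrightarrow> dist e a"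
      by (intro tendsto_intros conv_tendsto[OF conv' x(1)])
    then show ?thesis by (rule LIMSEQ_le_const2) (use s_inv[OF x(2)] less_imp_le in auto)
  qed
  have "b \<noteq> e" "a \<noteq> c" "c \<noteq> e"
    using c e ab \<open>0 < \<delta>\<close> dist_triangle3[of a b c] by (auto simp: dist_commute)
  have "\<phi> q c = c"
  proof (rule LIMSEQ_unique)
    show "(\<lambda>n. \<phi> q (\<phi> ((s \<circ> r) n) b)) \<longlonglongrightarrow> \<phi> q c"
      by (intro tendsto_act q conv_tendsto[OF conv \<open>b \<noteq> e\<close>])
    have "\<phi> q b \<noteq> e"
      using contr[of b] ba e ab \<open>0 < \<delta>\<close> dist_triangle3[of a b e] by (auto simp: dist_commute)
    from conv_tendsto[OF conv this] show "(\<lambda>n. \<phi> q (\<phi> ((s \<circ> r) n) b)) \<longlonglongrightarrow> c"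
      by (simp add: act_mult[symmetric] q sG qs)
  qed
  have "\<phi> (inv q) e = e"
  proof (rule LIMSEQ_unique)
    show "(\<lambda>n. \<phi> (inv q) (\<phi> (inv ((s \<circ> r) n)) a)) \<longlonglongrightarrow> \<phi> (inv q) e"
      by (intro tendsto_act inv_closed q conv_tendsto[OF conv' \<open>a \<noteq> c\<close>])
    have "dist (\<phi> (inv q) a) a < \<delta>"
      using contr[of "\<phi> (inv q) a"] q ba by fastforce
    then have "\<phi> (inv q) a \<noteq> c"
      using c ab \<open>0 < \<delta>\<close> dist_triangle3[of a b c] by (auto simp: dist_commute)
    from conv_tendsto[OF conv' this]
    show "(\<lambda>n. \<phi> (inv q) (\<phi> (inv ((s \<circ> r) n)) a)) \<longlonglongrightarrow> e"
      by (simp add: act_mult[symmetric] q sG qs inv_mult_group[symmetric])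
  qed
  then have "\<phi> q e = e" using q by (metis act_inv_right)
  have "\<phi> (s k) c = c" for k
    by (induction k) (use \<open>\<phi> q c = c\<close> q sG in \<open>auto simp: s_Suc act_mult\<close>, simp add: s_def)
  then have "\<phi> (inv ((s \<circ> r) n)) c = c" for n
    using sG by (metis act_inv_left comp_apply)
  then have "conical G \<phi> c"
    unfolding conical_def using conv' \<open>c \<noteq> e\<close>
    by (intro exI[of _ "\<lambda>n. inv ((s \<circ> r) n)"] exI[of _ e] exI[of _ c]) simp
  moreover have "\<exists>k::nat. dist (\<phi> (q [^] k) z) c < \<rho>" if "0 < \<rho>" for \<rho>
  proof -
    have "z \<noteq> e" using z e by auto
    then have "\<forall>\<^sub>F n in sequentially. dist (\<phi> ((s \<circ> r) n) z) c < \<rho>"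
      using conv_tendsto[OF conv] that by (metis tendstoD)
    then obtain n where "dist (\<phi> ((s \<circ> r) n) z) c < \<rho>"
      using eventually_happens'[OF sequentially_bot] by blast
    then show ?thesis unfolding s_def comp_def by blast
  qed
  ultimately show ?thesis using c e \<open>\<phi> q c = c\<close> \<open>\<phi> q e = e\<close> that by blast
qed

lemma conv_loxodromic:
  assumes "conv g a b" "a \<noteq> b" "z \<noteq> a" "z \<noteq> b" "0 < \<rho>"
  obtains n c e where "dist c b < \<rho>" "dist e a < \<rho>" "conical G \<phi> c"
    "\<phi> (g n) c = c" "\<phi> (g n) e = e"
    "\<And>\<rho>. 0 < \<rho> \<Longrightarrow> \<exists>k::nat. dist (\<phi> (g n [^] k) z) c < \<rho>"
proof -
  define m where "m = Min {\<rho>, dist a b, dist z a, dist z b}"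
  have m: "0 < m" "m \<le> \<rho>" "m \<le> dist a b" "m \<le> dist z a" "m \<le> dist z b"
    unfolding m_def using assms(2-5) by simp_all
  define \<delta> where "\<delta> = m / 3"
  have \<delta>: "0 < \<delta>" "3 * \<delta> \<le> dist a b" "\<delta> < dist z a" "\<delta> < dist z b" "\<delta> < \<rho>"
    using m by (simp_all add: \<delta>_def)
  obtain n where "\<forall>z. \<delta> \<le> dist z a \<longrightarrow> dist (\<phi> (g n) z) b < \<delta>"
    using eventually_happens'[OF sequentially_bot conv_eventually[OF assms(1) \<delta>(1) \<delta>(1)]] by blast
  then obtain c e where "dist c b \<le> \<delta>" "dist e a \<le> \<delta>" "conical G \<phi> c"
    "\<phi> (g n) c = c" "\<phi> (g n) e = e"
    "\<And>\<rho>. 0 < \<rho> \<Longrightarrow> \<exists>k::nat. dist (\<phi> (g n [^] k) z) c < \<rho>"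
    using loxodromic[OF conv_carrier[OF assms(1), of n] \<delta>(1-4)] by blast
  with \<delta>(5) show ?thesis using that[of c e n] by (meson le_less_trans)
qed

section \<open>The orbit uniform metric\<close>

text \<open>Closeness in the orbit uniform metric of \<open>dist\<close>, without the supremum. Passing to $d$ only needs
  that the two metrics are uniformly equivalent.\<close>

definition uniformly_close :: "real \<Rightarrow> 'm \<Rightarrow> 'm \<Rightarrow> bool"
  where "uniformly_close e x y \<longleftrightarrow> (\<forall>g\<in>carrier G. dist (\<phi> g x) (\<phi> g y) \<le> e)"

lemma uniformly_closeD: "\<lbrakk>uniformly_close e x y; g \<in> carrier G\<rbrakk> \<Longrightarrow> dist (\<phi> g x) (\<phi> g y) \<le> e"
  unfolding uniformly_close_def by blast

lemma uniformly_close_dist: "uniformly_close e x y \<Longrightarrow> dist x y \<le> e"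
  using uniformly_closeD[of e x y \<one>] by simp

lemma uniformly_close_refl: "0 \<le> e \<Longrightarrow> uniformly_close e x x"
  unfolding uniformly_close_def by simp

lemma uniformly_close_sym: "uniformly_close e x y \<Longrightarrow> uniformly_close e y x"
  unfolding uniformly_close_def by (simp add: dist_commute)

lemma uniformly_close_mono: "\<lbrakk>uniformly_close e x y; e \<le> e'\<rbrakk> \<Longrightarrow> uniformly_close e' x y"
  unfolding uniformly_close_def by force

lemma uniformly_close_trans:
  "\<lbrakk>uniformly_close e x y; uniformly_close e' y z\<rbrakk> \<Longrightarrow> uniformly_close (e + e') x z"
  unfolding uniformly_close_def by (meson add_mono dist_triangle order_trans)

lemma uniformly_close_act:
  assumes "uniformly_close e x y" "k \<in> carrier G"
  shows "uniformly_close e (\<phi> k x) (\<phi> k y)"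
  unfolding uniformly_close_def
proof
  fix g assume "g \<in> carrier G"
  then show "dist (\<phi> g (\<phi> k x)) (\<phi> g (\<phi> k y)) \<le> e"
    using uniformly_closeD[OF assms(1), of "g \<otimes> k"] assms(2) by (simp add: act_mult)
qed

lemma uniformly_close_lim:
  assumes "y \<longlonglongrightarrow> l" "\<And>n. uniformly_close e x (y n)"
  shows "uniformly_close e x l"
  unfolding uniformly_close_def
proof
  fix g assume g: "g \<in> carrier G"
  have "(\<lambda>n. dist (\<phi> g x) (\<phi> g (y n))) \<longlonglongrightarrow> dist (\<phi> g x) (\<phi> g l)"
    by (intro tendsto_intros tendsto_act g assms(1))
  then show "dist (\<phi> g x) (\<phi> g l) \<le> e"
    by (rule LIMSEQ_le_const2) (use uniformly_closeD[OF assms(2) g] in auto)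
qed

section \<open>Orbits of nonconical points\<close>

text \<open>An infinite set would contain a convergence sequence. Its attracting point attracts the
  nonconical \<open>\<xi>\<close> and also one of \<open>x\<close>, \<open>y\<close>, since at most
  one of these is repelling.\<close>

lemma finite_separating:
  assumes "\<not> conical G \<phi> \<xi>" "x \<noteq> y" "0 < s"
  shows "finite {g \<in> carrier G. s \<le> dist (\<phi> g \<xi>) (\<phi> g x) \<and> s \<le> dist (\<phi> g \<xi>) (\<phi> g y)}"
    (is "finite ?S")
proof (rule ccontr)
  assume "infinite ?S"
  then obtain g a b where g: "conv g a b" and gS: "\<And>n. g n \<in> ?S"
    using subconvergence_infinite[of ?S] by blast
  obtain z where z: "z \<in> {x, y}" "z \<noteq> a" using assms(2) by blast
  have "(\<lambda>n. dist (\<phi> (g n) \<xi>) (\<phi> (g n) z)) \<longlonglongrightarrow> dist b b"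
    by (intro tendsto_dist conv_tendsto[OF g z(2)] nonconical_tendsto[OF assms(1) g])
  then have "s \<le> dist b b"
    by (rule LIMSEQ_le_const) (use gS z(1) in auto)
  with assms(3) show False by simp
qed

text \<open>The \<open>f\<close> of the conclusion is one whose separated set is maximal. An
  arbitrary separating \<open>g\<close> is thus replaced by an element that agrees at
  \<open>\<xi>\<close>, up to \<open>\<epsilon>\<close>, with one of finitely many
  \<open>k\<close>.\<close>

lemma finite_orbit_net:
  assumes nc: "\<not> conical G \<phi> \<xi>" and "0 < \<epsilon>"
  obtains T where "finite T" "T \<subseteq> carrier G"
    "\<forall>\<eta>. \<forall>g\<in>carrier G. \<epsilon> / 4 \<le> dist (\<phi> g \<xi>) (\<phi> g \<eta>) \<longrightarrow>
      (\<exists>f\<in>carrier G. \<exists>k\<in>T. \<epsilon> / 4 \<le> dist (\<phi> f \<xi>) (\<phi> f \<eta>) \<and> uniformly_close \<epsilon> (\<phi> k \<xi>) (\<phi> f \<xi>))"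
proof -
  define s where "s = \<epsilon> / 4"
  have "0 < s" using \<open>0 < \<epsilon>\<close> by (simp add: s_def)
  \<comment> \<open>As $g$ leaves finite sets, \<open>C g\<close> shrinks to a point, since $\xi$ is not conical.\<close>
  define C where "C = (\<lambda>g. {z. s \<le> dist (\<phi> g \<xi>) (\<phi> g z)})"
  define F where "F = {f \<in> carrier G. \<forall>f'\<in>carrier G. \<not> C f \<subset> C f'}"
  have max: "\<exists>f\<in>F. \<eta> \<in> C f" if g: "g \<in> carrier G" "\<eta> \<in> C g" for g \<eta>
  proof (cases "g \<in> F")
    case False
    then obtain g' where g': "g' \<in> carrier G" "C g \<subset> C g'" using g(1) by (auto simp: F_def)
    then obtain \<zeta> where \<zeta>: "\<zeta> \<in> C g'" "\<zeta> \<notin> C g" by blast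
    \<comment> \<open>Only finitely many \<open>f\<close> separate \<open>\<xi>\<close> from both
      \<open>\<eta>\<close> and \<open>\<zeta>\<close>, so some \<open>C f\<close> is maximal among
      them. It is maximal altogether, since any larger set again contains both points.\<close>
    define X where "X = {f \<in> carrier G. \<eta> \<in> C f \<and> \<zeta> \<in> C f}"
    have "\<eta> \<noteq> \<zeta>" using g(2) \<zeta>(2) by blast
    then have "finite X" unfolding X_def C_def
      using finite_separating[OF nc _ \<open>0 < s\<close>] by simp
    moreover have "g' \<in> X" unfolding X_def using g g' \<zeta>(1) by blast
    ultimately obtain f where f: "f \<in> X" "\<And>f'. f' \<in> X \<Longrightarrow> \<not> C f \<subset> C f'"
      using finite_has_maximal[of "C ` X"] by (metis empty_iff finite_imageI imageE image_eqI psubsetE)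
    have "f' \<in> X" if "f' \<in> carrier G" "C f \<subset> C f'" for f'
      using that f(1) unfolding X_def by blast
    then have "f \<in> F" using f unfolding F_def X_def by blast
    then show ?thesis using f(1) unfolding X_def by blast
  qed (use g in blast)
  have "\<exists>T. finite T \<and> T \<subseteq> F \<and> (\<forall>f\<in>F. \<exists>k\<in>T. uniformly_close \<epsilon> (\<phi> k \<xi>) (\<phi> f \<xi>))"
  proof (rule ccontr)
    assume "\<not> ?thesis"
    then have "\<And>T. finite T \<Longrightarrow> T \<subseteq> F \<Longrightarrow> \<exists>f\<in>F. \<forall>k\<in>T. \<not> uniformly_close \<epsilon> (\<phi> k \<xi>) (\<phi> f \<xi>)"
      by meson
    then obtain g :: "nat \<Rightarrow> 'g" where gF: "\<And>n. g n \<in> F"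
      and sep: "\<And>m n. m < n \<Longrightarrow> \<not> uniformly_close \<epsilon> (\<phi> (g m) \<xi>) (\<phi> (g n) \<xi>)"
      using exists_pairwise_sequence[of F "\<lambda>k f. \<not> uniformly_close \<epsilon> (\<phi> k \<xi>) (\<phi> f \<xi>)"] by metis
    have gG: "g n \<in> carrier G" for n using gF F_def by blast
    have "inj g"
    proof (rule linorder_injI)
      show "g m \<noteq> g n" if "m < n" for m n
        using sep[OF that] uniformly_close_refl[of \<epsilon> "\<phi> (g n) \<xi>"] \<open>0 < \<epsilon>\<close> by auto
    qed
    then obtain r a b where r: "strict_mono r" "conv (g \<circ> r) a b"
      using subconvergence gG by blast
    define x where "x = (\<lambda>n. \<phi> (g (r n)) \<xi>)"
    have x: "x \<longlonglongrightarrow> b" using nonconical_tendsto[OF nc r(2)] by (simp add: x_def)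
    have x': "(\<lambda>n. x (Suc n)) \<longlonglongrightarrow> b" using x by (rule LIMSEQ_Suc)
    have "\<exists>h\<in>carrier G. \<epsilon> < dist (\<phi> h (x n)) (\<phi> h (x (Suc n)))" for n
      using sep[of "r n" "r (Suc n)"] r(1)
      unfolding uniformly_close_def x_def by (auto simp: not_le strict_mono_Suc_iff)
    then obtain h where h: "\<And>n. h n \<in> carrier G"
      "\<And>n. \<epsilon> < dist (\<phi> (h n) (x n)) (\<phi> (h n) (x (Suc n)))" by metis
    \<comment> \<open>Consecutive points \<open>x n\<close> share the limit \<open>b\<close> but are
      separated by \<open>h n\<close>, so \<open>b\<close> must repel.\<close>
    obtain r' a' w where r': "strict_mono r'" "conv (h \<circ> r') a' w" "a' = b \<or> a' = b"
      by (rule subconvergence_separated[OF h(1) x x' \<open>0 < \<epsilon>\<close> less_imp_le[OF h(2)]])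
        (use \<open>0 < \<epsilon>\<close> in auto)
    have "conv (h \<circ> r') b w" using r' by simp
    then have "\<forall>\<^sub>F n in sequentially. \<forall>z. s / 2 \<le> dist z b \<longrightarrow> dist (\<phi> ((h \<circ> r') n) z) w < \<epsilon> / 8"
      by (rule conv_eventually) (use \<open>0 < s\<close> \<open>0 < \<epsilon>\<close> in auto)
    moreover have "\<forall>\<^sub>F n in sequentially. dist (x (r' n)) b < s / 2"
      "\<forall>\<^sub>F n in sequentially. dist (x (Suc (r' n))) b < s / 2"
      using tendstoD[OF LIMSEQ_subseq_LIMSEQ[OF x r'(1)], of "s / 2"]
        tendstoD[OF LIMSEQ_subseq_LIMSEQ[OF x' r'(1)], of "s / 2"] \<open>0 < s\<close>
      by (simp_all add: comp_def)
    ultimately have "\<forall>\<^sub>F n in sequentially.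
        (\<forall>z. s / 2 \<le> dist z b \<longrightarrow> dist (\<phi> ((h \<circ> r') n) z) w < \<epsilon> / 8) \<and>
        dist (x (r' n)) b < s / 2 \<and> dist (x (Suc (r' n))) b < s / 2"
      by (simp add: eventually_conj)
    then obtain n where n: "\<And>z. s / 2 \<le> dist z b \<Longrightarrow> dist (\<phi> (h (r' n)) z) w < \<epsilon> / 8"
      "dist (x (r' n)) b < s / 2" "dist (x (Suc (r' n))) b < s / 2"
      using eventually_happens'[OF sequentially_bot] by fastforce
    define k where "k = h (r' n)"
    have k: "k \<in> carrier G" "\<epsilon> < dist (\<phi> k (x (r' n))) (\<phi> k (x (Suc (r' n))))"
      using h unfolding k_def by auto
    \<comment> \<open>The two images are more than \<open>\<epsilon>\<close> apart, so one of them,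
      with index \<open>i\<close>, is at least \<open>\<epsilon> / 2\<close> from the attracting
      point \<open>w\<close>. Everything away from \<open>b\<close> goes near \<open>w\<close>,
      hence stays separated from that image.\<close>
    have "\<exists>i j. {i, j} = {r' n, Suc (r' n)} \<and> \<epsilon> / 2 \<le> dist (\<phi> k (x i)) w"
    proof (cases "\<epsilon> / 2 \<le> dist (\<phi> k (x (r' n))) w")
      case False
      then have "\<epsilon> / 2 \<le> dist (\<phi> k (x (Suc (r' n)))) w"
        using k(2) dist_triangle2[of "\<phi> k (x (r' n))" "\<phi> k (x (Suc (r' n)))" w] by simp
      then show ?thesis by (metis insert_commute)
    qed blast
    then obtain i j where ij: "{i, j} = {r' n, Suc (r' n)}" "\<epsilon> / 2 \<le> dist (\<phi> k (x i)) w" by blast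
    have xij: "dist (x i) b < s / 2" "dist (x j) b < s / 2" "\<epsilon> < dist (\<phi> k (x i)) (\<phi> k (x j))"
      using ij(1) n(2,3) k(2) by (auto simp: doubleton_eq_iff dist_commute)
    have x_i: "\<phi> (g (r i)) \<xi> = x i" by (simp add: x_def)
    \<comment> \<open>\<open>C f\<close> is strictly larger than \<open>C (g (r i))\<close>: it also contains the preimage of \<open>x j\<close>.\<close>
    define f where "f = k \<otimes> g (r i)"
    have f: "f \<in> carrier G" "\<And>z. \<phi> f z = \<phi> k (\<phi> (g (r i)) z)"
      unfolding f_def using k(1) gG by (auto simp: act_mult)
    have "C (g (r i)) \<subseteq> C f"
    proof
      fix z assume "z \<in> C (g (r i))"
      then have "s \<le> dist (x i) (\<phi> (g (r i)) z)" by (simp add: C_def x_i)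
      then have "s / 2 \<le> dist (\<phi> (g (r i)) z) b"
        using xij(1) dist_triangle2[of "x i" "\<phi> (g (r i)) z" b] by simp
      then have "dist (\<phi> k (\<phi> (g (r i)) z)) w < \<epsilon> / 8" using n(1) k_def by blast
      then have "\<epsilon> / 4 \<le> dist (\<phi> k (x i)) (\<phi> k (\<phi> (g (r i)) z))"
        using ij(2) dist_triangle[of "\<phi> k (x i)" w "\<phi> k (\<phi> (g (r i)) z)"] \<open>0 < \<epsilon>\<close> by linarith
      then show "z \<in> C f" by (simp add: C_def f x_i s_def)
    qed
    moreover have "\<phi> (inv (g (r i))) (x j) \<in> C f"
      using xij(3) \<open>0 < \<epsilon>\<close> gG by (simp add: C_def f x_i s_def)
    moreover have "\<phi> (inv (g (r i))) (x j) \<notin> C (g (r i))"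
      using xij(1,2) dist_triangle2[of "x i" "x j" b] gG by (simp add: C_def x_i)
    ultimately have "C (g (r i)) \<subset> C f" by blast
    with f(1) gF[of "r i"] show False by (simp add: F_def)
  qed
  then obtain T where T: "finite T" "T \<subseteq> F" "\<And>f. f \<in> F \<Longrightarrow> \<exists>k\<in>T. uniformly_close \<epsilon> (\<phi> k \<xi>) (\<phi> f \<xi>)"
    by blast
  show ?thesis
  proof (rule that[OF T(1)])
    show "T \<subseteq> carrier G" using T(2) F_def by blast
    have "\<exists>f\<in>carrier G. \<exists>k\<in>T.
        \<epsilon> / 4 \<le> dist (\<phi> f \<xi>) (\<phi> f \<eta>) \<and> uniformly_close \<epsilon> (\<phi> k \<xi>) (\<phi> f \<xi>)"
      if g: "g \<in> carrier G" "\<epsilon> / 4 \<le> dist (\<phi> g \<xi>) (\<phi> g \<eta>)" for \<eta> g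
    proof -
      obtain f where "f \<in> F" "\<eta> \<in> C f" using max[OF g(1)] g(2) by (auto simp: C_def s_def)
      with T(3) show ?thesis unfolding F_def C_def s_def by blast
    qed
    then show "\<forall>\<eta>. \<forall>g\<in>carrier G. \<epsilon> / 4 \<le> dist (\<phi> g \<xi>) (\<phi> g \<eta>) \<longrightarrow>
        (\<exists>f\<in>carrier G. \<exists>k\<in>T. \<epsilon> / 4 \<le> dist (\<phi> f \<xi>) (\<phi> f \<eta>) \<and> uniformly_close \<epsilon> (\<phi> k \<xi>) (\<phi> f \<xi>))"
      by blast
  qed
qed

section \<open>Coarse stabilizers\<close>

text \<open>In a hyperbolic space $h^{-1}o$ would be a point near the axis from $e$ to $c$ of a loxodromic $g$
  such that the projections of $z$ and $gz$ to the axis lie on different sides of it.\<close>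

lemma axis_crossing:
  assumes nc: "\<not> conical G \<phi> \<xi>" and "0 < \<epsilon>"
    and q: "conv q a b" "a \<noteq> b" and z: "z \<noteq> a" "z \<noteq> b"
    and close: "\<And>n. uniformly_close \<epsilon> \<xi> (\<phi> (q n) \<xi>)"
    and far: "\<And>c. conical G \<phi> c \<Longrightarrow> \<not> uniformly_close (3 * \<epsilon>) \<xi> c"
    and "0 < \<delta>"
  obtains h g c e where "h \<in> carrier G" "g \<in> carrier G" "dist c b < \<delta>" "dist e a < \<delta>"
    "\<phi> g c = c" "\<phi> g e = e" "uniformly_close \<epsilon> \<xi> (\<phi> g \<xi>)"
    "5 / 2 * \<epsilon> \<le> dist (\<phi> h c) (\<phi> h e)"
    "2 * \<epsilon> < dist (\<phi> h z) (\<phi> h c)" "dist (\<phi> h (\<phi> g z)) (\<phi> h c) \<le> 2 * \<epsilon>"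
proof -
  have \<xi>b: "uniformly_close \<epsilon> \<xi> b"
    by (rule uniformly_close_lim[OF nonconical_tendsto[OF nc q(1)] close])
  have "\<exists>n c e. dist c b < \<delta> / real (Suc m) \<and> dist e a < \<delta> / real (Suc m) \<and> conical G \<phi> c \<and>
      \<phi> (q n) c = c \<and> \<phi> (q n) e = e \<and> (\<forall>\<rho>>0. \<exists>k::nat. dist (\<phi> (q n [^] k) z) c < \<rho>)" for m
  proof -
    have "0 < \<delta> / real (Suc m)" using \<open>0 < \<delta>\<close> by simp
    then show ?thesis by (rule conv_loxodromic[OF q z]) blast
  qed
  then obtain p c e where cb: "\<And>m. dist (c m) b < \<delta> / real (Suc m)"
    and ea: "\<And>m. dist (e m) a < \<delta> / real (Suc m)" and con: "\<And>m. conical G \<phi> (c m)"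
    and fix_c: "\<And>m. \<phi> (q (p m)) (c m) = c m" and fix_e: "\<And>m. \<phi> (q (p m)) (e m) = e m"
    and orbit: "\<And>m \<rho>. 0 < \<rho> \<Longrightarrow> \<exists>k::nat. dist (\<phi> (q (p m) [^] k) z) (c m) < \<rho>"
    by metis
  have lim: "c \<longlonglongrightarrow> b" "e \<longlonglongrightarrow> a"
    using tendsto_dist_less cb ea by blast+
  have "\<exists>h\<in>carrier G. 3 * \<epsilon> < dist (\<phi> h \<xi>) (\<phi> h (c m))" for m
    using far[OF con[of m]] unfolding uniformly_close_def by (auto simp: not_le)
  then obtain h where hG: "\<And>m. h m \<in> carrier G"
    and h: "\<And>m. 3 * \<epsilon> < dist (\<phi> (h m) \<xi>) (\<phi> (h m) (c m))"
    by metis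
  have \<xi>b': "dist (\<phi> g \<xi>) (\<phi> g b) < 3 * \<epsilon>" if "g \<in> carrier G" for g
    using uniformly_closeD[OF \<xi>b that] \<open>0 < \<epsilon>\<close> by simp
  have pos: "0 < 3 * \<epsilon>" using \<open>0 < \<epsilon>\<close> by simp
  obtain r \<alpha> \<beta> where r: "strict_mono r" "conv (h \<circ> r) \<alpha> \<beta>" "\<alpha> = \<xi> \<or> \<alpha> = b"
    by (rule subconvergence_separated[OF hG tendsto_const lim(1) pos less_imp_le[OF h] \<xi>b'])
  have cr: "(c \<circ> r) \<longlonglongrightarrow> b" and er: "(e \<circ> r) \<longlonglongrightarrow> a"
    using lim r(1) by (auto intro: LIMSEQ_subseq_LIMSEQ)
  have h\<xi>: "(\<lambda>n. \<phi> ((h \<circ> r) n) \<xi>) \<longlonglongrightarrow> \<beta>" by (rule nonconical_tendsto[OF nc r(2)])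
  have "\<alpha> = b"
  proof (rule ccontr)
    assume "\<alpha> \<noteq> b"
    then have "(\<lambda>n. dist (\<phi> ((h \<circ> r) n) \<xi>) (\<phi> ((h \<circ> r) n) ((c \<circ> r) n))) \<longlonglongrightarrow> dist \<beta> \<beta>"
      by (intro tendsto_dist h\<xi> conv_tendsto_moving[OF r(2) cr]) auto
    then have "3 * \<epsilon> \<le> dist \<beta> \<beta>"
      by (rule LIMSEQ_le_const) (use h less_imp_le in auto)
    with \<open>0 < \<epsilon>\<close> show False by simp
  qed
  \<comment> \<open>As \<open>b\<close> repels, \<open>h\<close> gathers \<open>\<xi>\<close>,
    \<open>e\<close> and \<open>z\<close> near \<open>\<beta>\<close>, away from the image of
    \<open>c\<close>.\<close>
  have "(\<lambda>n. \<phi> ((h \<circ> r) n) ((e \<circ> r) n)) \<longlonglongrightarrow> \<beta>" "(\<lambda>n. \<phi> ((h \<circ> r) n) z) \<longlonglongrightarrow> \<beta>"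
    using \<open>\<alpha> = b\<close> q(2) z conv_tendsto_moving[OF r(2) er] conv_tendsto[OF r(2)] by auto
  with h\<xi> have "\<forall>\<^sub>F n in sequentially. dist (\<phi> (h (r n)) \<xi>) \<beta> < \<epsilon> / 8"
    "\<forall>\<^sub>F n in sequentially. dist (\<phi> (h (r n)) (e (r n))) \<beta> < \<epsilon> / 8"
    "\<forall>\<^sub>F n in sequentially. dist (\<phi> (h (r n)) z) \<beta> < \<epsilon> / 8"
    using tendstoD[of _ \<beta> sequentially "\<epsilon> / 8"] \<open>0 < \<epsilon>\<close> by (auto simp: comp_def)
  then have "\<forall>\<^sub>F n in sequentially. dist (\<phi> (h (r n)) \<xi>) \<beta> < \<epsilon> / 8 \<and>
      dist (\<phi> (h (r n)) (e (r n))) \<beta> < \<epsilon> / 8 \<and> dist (\<phi> (h (r n)) z) \<beta> < \<epsilon> / 8"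
    by (simp add: eventually_conj)
  then obtain n where n: "dist (\<phi> (h (r n)) \<xi>) \<beta> < \<epsilon> / 8"
    "dist (\<phi> (h (r n)) (e (r n))) \<beta> < \<epsilon> / 8" "dist (\<phi> (h (r n)) z) \<beta> < \<epsilon> / 8"
    using eventually_happens'[OF sequentially_bot] by fastforce
  define m where "m = r n"
  define g where "g = q (p m)"
  have gG: "g \<in> carrier G" unfolding g_def by (rule conv_carrier[OF q(1)])
  \<comment> \<open>The loss of \<open>\<epsilon> / 4\<close> leaves
    \<open>11 / 4 * \<epsilon>\<close>, still above the \<open>5 / 2 * \<epsilon>\<close> needed for
    \<open>e\<close> and the \<open>2 * \<epsilon>\<close> needed for \<open>z\<close>.\<close>
  have far_\<xi>: "3 * \<epsilon> - \<epsilon> / 4 < dist (\<phi> (h m) x) (\<phi> (h m) (c m))" if "dist (\<phi> (h m) x) \<beta> < \<epsilon> / 8" for x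
    using that n(1) h[of m] dist_triangle2[of "\<phi> (h m) \<xi>" "\<phi> (h m) x" \<beta>]
      dist_triangle[of "\<phi> (h m) \<xi>" "\<phi> (h m) (c m)" "\<phi> (h m) x"] unfolding m_def by linarith
  \<comment> \<open>\<open>P k\<close> says that, seen through \<open>h m\<close>, the point
    \<open>\<phi> (g [^] k) z\<close> has come close to \<open>c m\<close>. It fails at 0 and holds
    somewhere, so it switches at some step \<open>j\<close>.\<close>
  define P where "P = (\<lambda>k::nat. dist (\<phi> (h m) (\<phi> (g [^] k) z)) (\<phi> (h m) (c m)) \<le> 2 * \<epsilon>)"
  obtain \<eta> where \<eta>: "0 < \<eta>" "\<And>x. dist x (c m) < \<eta> \<Longrightarrow> dist (\<phi> (h m) x) (\<phi> (h m) (c m)) < 2 * \<epsilon>"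
    using isCont_act[OF hG[of m], of "c m"] \<open>0 < \<epsilon>\<close> unfolding continuous_at_eps_delta
    by (metis mult_pos_pos zero_less_numeral)
  have "\<exists>k. P k"
    using orbit[OF \<eta>(1), of m] \<eta>(2) less_imp_le unfolding P_def g_def by blast
  moreover have "\<not> P 0"
    using far_\<xi>[of z] n(3) \<open>0 < \<epsilon>\<close> unfolding P_def m_def by simp
  ultimately obtain j where j: "\<not> P j" "P (Suc j)"
    by (metis not0_implies_Suc LeastI Least_le Suc_n_not_le_n)
  \<comment> \<open>This moves the switch to the step from \<open>z\<close> to
    \<open>\<phi> g z\<close>, while the images of the fixed points \<open>c m\<close> and
    \<open>e m\<close> are unchanged.\<close>
  define k where "k = h m \<otimes> g [^] j"
  have kG: "k \<in> carrier G" unfolding k_def using hG gG by simp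
  have k: "\<phi> k x = \<phi> (h m) (\<phi> (g [^] j) x)" for x
    unfolding k_def using hG gG by (simp add: act_mult)
  have pow_fix: "\<phi> (g [^] j) x = x" if "\<phi> g x = x" for x
    by (induction j) (use that gG in \<open>auto simp: act_mult\<close>)
  have kc: "\<phi> k (c m) = \<phi> (h m) (c m)" and ke: "\<phi> k (e m) = \<phi> (h m) (e m)"
    using fix_c[of m] fix_e[of m] pow_fix by (auto simp: k g_def)
  have small: "\<delta> / real (Suc m) \<le> \<delta>" using \<open>0 < \<delta>\<close> by (simp add: field_simps)
  show ?thesis
  proof (rule that[of k g "c m" "e m"])
    show "dist (c m) b < \<delta>" "dist (e m) a < \<delta>"
      using cb[of m] ea[of m] small by linarith+
    show "\<phi> g (c m) = c m" "\<phi> g (e m) = e m" "uniformly_close \<epsilon> \<xi> (\<phi> g \<xi>)"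
      using fix_c fix_e close by (auto simp: g_def)
    show "5 / 2 * \<epsilon> \<le> dist (\<phi> k (c m)) (\<phi> k (e m))"
      unfolding kc ke using far_\<xi>[of "e m"] n(2) \<open>0 < \<epsilon>\<close> by (simp add: m_def dist_commute)
    show "2 * \<epsilon> < dist (\<phi> k z) (\<phi> k (c m))"
      using j(1) by (simp add: P_def k[of z] kc)
    show "dist (\<phi> k (\<phi> g z)) (\<phi> k (c m)) \<le> 2 * \<epsilon>"
      using j(2) gG by (simp add: P_def k[of "\<phi> g z"] kc act_mult)
  qed (use kG gG in auto)
qed

text \<open>Otherwise \<open>axis_crossing\<close> provides \<open>h n\<close> and
  \<open>g n\<close>, with \<open>g n\<close> fixing points near \<open>a\<close> and
  \<open>b\<close>. Both \<open>h n\<close> and \<open>h n \<otimes> g n\<close> keep these fixed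
  points apart, so \<open>a\<close> or \<open>b\<close> repels for each. Every combination
  contradicts either the crossing of \<open>z\<close> or the small displacement of
  \<open>\<xi>\<close> by \<open>g n\<close>.\<close>

lemma conical_uniformly_close:
  assumes nc: "\<not> conical G \<phi> \<xi>" and "0 < \<epsilon>"
    and q: "conv q a b" "a \<noteq> b" and close: "\<And>n. uniformly_close \<epsilon> \<xi> (\<phi> (q n) \<xi>)"
  obtains c where "conical G \<phi> c" "uniformly_close (3 * \<epsilon>) \<xi> c"
proof (rule ccontr)
  assume "\<not> thesis"
  then have far: "\<And>c. conical G \<phi> c \<Longrightarrow> \<not> uniformly_close (3 * \<epsilon>) \<xi> c" using that by blast
  obtain z where z: "z \<noteq> a" "z \<noteq> b" by (rule third_point[OF nc q])
  have qG: "q n \<in> carrier G" for n by (rule conv_carrier[OF q(1)])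
  \<comment> \<open>Both \<open>a\<close> and \<open>b\<close> are limits of points within
    \<open>\<epsilon>\<close> of \<open>\<xi>\<close>, so no element moves them
    \<open>5 / 2 * \<epsilon>\<close> apart.\<close>
  have "uniformly_close \<epsilon> \<xi> b"
    by (rule uniformly_close_lim[OF nonconical_tendsto[OF nc q(1)] close])
  moreover have "uniformly_close \<epsilon> \<xi> a"
  proof (rule uniformly_close_lim[OF nonconical_tendsto[OF nc conv_inv[OF q(1)]]])
    show "uniformly_close \<epsilon> \<xi> (\<phi> (inv (q n)) \<xi>)" for n
      using uniformly_close_act[OF close inv_closed[OF qG], of n n] qG
      by (simp add: uniformly_close_sym)
  qed
  ultimately have "uniformly_close (\<epsilon> + \<epsilon>) b a"
    using uniformly_close_trans uniformly_close_sym by blast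
  then have ba: "dist (\<phi> k b) (\<phi> k a) < 5 / 2 * \<epsilon>" if "k \<in> carrier G" for k
    using uniformly_closeD[OF _ that] \<open>0 < \<epsilon>\<close> by force
  have "\<exists>h g c e. h \<in> carrier G \<and> g \<in> carrier G \<and>
      dist c b < 1 / real (Suc n) \<and> dist e a < 1 / real (Suc n) \<and>
      \<phi> g c = c \<and> \<phi> g e = e \<and> uniformly_close \<epsilon> \<xi> (\<phi> g \<xi>) \<and>
      5 / 2 * \<epsilon> \<le> dist (\<phi> h c) (\<phi> h e) \<and>
      2 * \<epsilon> < dist (\<phi> h z) (\<phi> h c) \<and> dist (\<phi> h (\<phi> g z)) (\<phi> h c) \<le> 2 * \<epsilon>" for n
  proof -
    have "0 < 1 / real (Suc n)" by simp
    from axis_crossing[OF nc \<open>0 < \<epsilon>\<close> q z close far this] show ?thesis by (smt (verit, best))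
  qed
  then obtain h g c e where hG: "\<And>n. h n \<in> carrier G" and gG: "\<And>n. g n \<in> carrier G"
    and cb: "\<And>n. dist (c n) b < 1 / real (Suc n)" and ea: "\<And>n. dist (e n) a < 1 / real (Suc n)"
    and fix_c: "\<And>n. \<phi> (g n) (c n) = c n" and fix_e: "\<And>n. \<phi> (g n) (e n) = e n"
    and g\<xi>: "\<And>n. uniformly_close \<epsilon> \<xi> (\<phi> (g n) \<xi>)"
    and ce: "\<And>n. 5 / 2 * \<epsilon> \<le> dist (\<phi> (h n) (c n)) (\<phi> (h n) (e n))"
    and zc: "\<And>n. 2 * \<epsilon> < dist (\<phi> (h n) z) (\<phi> (h n) (c n))"
    and gzc: "\<And>n. dist (\<phi> (h n) (\<phi> (g n) z)) (\<phi> (h n) (c n)) \<le> 2 * \<epsilon>"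
    by metis
  have lim: "c \<longlonglongrightarrow> b" "e \<longlonglongrightarrow> a"
    using tendsto_dist_less cb ea by blast+
  have pos: "0 < 5 / 2 * \<epsilon>" using \<open>0 < \<epsilon>\<close> by simp
  obtain r \<alpha> \<beta> where r: "strict_mono r" "conv (h \<circ> r) \<alpha> \<beta>" "\<alpha> = b \<or> \<alpha> = a"
    by (rule subconvergence_separated[OF hG lim pos ce ba])
  define f where "f = (\<lambda>n. h (r n) \<otimes> g (r n))"
  have fG: "f n \<in> carrier G" for n unfolding f_def using hG gG by simp
  have f: "\<phi> (f n) x = \<phi> (h (r n)) (\<phi> (g (r n)) x)" for n x
    unfolding f_def using hG gG by (simp add: act_mult)
  have lim_r: "(c \<circ> r) \<longlonglongrightarrow> b" "(e \<circ> r) \<longlonglongrightarrow> a"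
    using lim r(1) by (auto intro: LIMSEQ_subseq_LIMSEQ)
  have "5 / 2 * \<epsilon> \<le> dist (\<phi> (f n) ((c \<circ> r) n)) (\<phi> (f n) ((e \<circ> r) n))" for n
    using ce[of "r n"] by (simp add: f fix_c fix_e)
  then obtain r' \<alpha>' \<beta>' where r': "strict_mono r'" "conv (f \<circ> r') \<alpha>' \<beta>'" "\<alpha>' = b \<or> \<alpha>' = a"
    by (rule subconvergence_separated[OF fG lim_r pos _ ba])
  define t where "t = r \<circ> r'"
  have t: "strict_mono t" unfolding t_def by (rule strict_mono_o[OF r(1) r'(1)])
  have ht: "conv (h \<circ> t) \<alpha> \<beta>" using conv_subseq[OF r(2) r'(1)] by (simp add: t_def comp_assoc)
  have lim_t: "(c \<circ> t) \<longlonglongrightarrow> b" "(e \<circ> t) \<longlonglongrightarrow> a"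
    using lim t by (auto intro: LIMSEQ_subseq_LIMSEQ)
  have ft: "\<phi> ((f \<circ> r') n) x = \<phi> (h (t n)) (\<phi> (g (t n)) x)" for n x
    by (simp add: f t_def)
  \<comment> \<open>If \<open>a\<close> repelled, the images of \<open>z\<close> and
    \<open>c\<close> would merge, against \<open>zc\<close>.\<close>
  have "\<alpha> = b"
  proof (rule ccontr)
    assume "\<alpha> \<noteq> b"
    then have "\<alpha> = a" using r(3) by simp
    then have "(\<lambda>n. dist (\<phi> ((h \<circ> t) n) z) (\<phi> ((h \<circ> t) n) ((c \<circ> t) n))) \<longlonglongrightarrow> dist \<beta> \<beta>"
      using z(1) q(2) by (intro tendsto_dist conv_tendsto[OF ht] conv_tendsto_moving[OF ht lim_t(1)]) auto
    then have "2 * \<epsilon> \<le> dist \<beta> \<beta>"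
      by (rule LIMSEQ_le_const) (use zc less_imp_le in auto)
    with \<open>0 < \<epsilon>\<close> show False by simp
  qed
  then have he: "(\<lambda>n. \<phi> ((h \<circ> t) n) ((e \<circ> t) n)) \<longlonglongrightarrow> \<beta>"
    using q(2) by (intro conv_tendsto_moving[OF ht lim_t(2)]) auto
  from r'(3) show False
  proof
    \<comment> \<open>The common images of \<open>e\<close> force equal attracting points, so under
      \<open>h\<close> the images of \<open>\<phi> (g n) z\<close> and \<open>e\<close> merge. But
      the former stay within \<open>2 * \<epsilon>\<close> of the images of \<open>c\<close>, which
      are \<open>5 / 2 * \<epsilon>\<close> from those of \<open>e\<close>.\<close>
    assume "\<alpha>' = b"
    then have "(\<lambda>n. \<phi> ((f \<circ> r') n) ((e \<circ> t) n)) \<longlonglongrightarrow> \<beta>'"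
      using q(2) by (intro conv_tendsto_moving[OF r'(2) lim_t(2)]) auto
    moreover have "(\<lambda>n. \<phi> ((f \<circ> r') n) ((e \<circ> t) n)) = (\<lambda>n. \<phi> ((h \<circ> t) n) ((e \<circ> t) n))"
      unfolding ft by (simp add: fix_e)
    ultimately have "\<beta>' = \<beta>" using he LIMSEQ_unique by fastforce
    then have "(\<lambda>n. \<phi> (h (t n)) (\<phi> (g (t n)) z)) \<longlonglongrightarrow> \<beta>"
      using conv_tendsto[OF r'(2), of z] z(2) \<open>\<alpha>' = b\<close> unfolding ft by simp
    with he have "(\<lambda>n. dist (\<phi> (h (t n)) (\<phi> (g (t n)) z)) (\<phi> ((h \<circ> t) n) ((e \<circ> t) n))) \<longlonglongrightarrow> dist \<beta> \<beta>"
      by (intro tendsto_dist)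
    moreover have "\<epsilon> / 2 \<le> dist (\<phi> (h (t n)) (\<phi> (g (t n)) z)) (\<phi> ((h \<circ> t) n) ((e \<circ> t) n))" for n
      using ce[of "t n"] gzc[of "t n"]
        dist_triangle3[of "\<phi> (h (t n)) (c (t n))" "\<phi> (h (t n)) (e (t n))" "\<phi> (h (t n)) (\<phi> (g (t n)) z)"]
      by simp
    ultimately have "\<epsilon> / 2 \<le> dist \<beta> \<beta>" by (intro LIMSEQ_le_const) auto
    with \<open>0 < \<epsilon>\<close> show False by simp
  next
    \<comment> \<open>Now the images of \<open>c\<close> and \<open>e\<close> tend to the two
      attracting points, which are therefore far apart. The images of \<open>\<xi>\<close> put them
      within \<open>\<epsilon>\<close>, because \<open>g n\<close> hardly moves
      \<open>\<xi>\<close>.\<close>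
    assume "\<alpha>' = a"
    then have "(\<lambda>n. \<phi> ((f \<circ> r') n) ((c \<circ> t) n)) \<longlonglongrightarrow> \<beta>'"
      using q(2) by (intro conv_tendsto_moving[OF r'(2) lim_t(1)]) auto
    then have "(\<lambda>n. \<phi> (h (t n)) (c (t n))) \<longlonglongrightarrow> \<beta>'"
      unfolding ft by (simp add: fix_c)
    with he have "(\<lambda>n. dist (\<phi> (h (t n)) (c (t n))) (\<phi> ((h \<circ> t) n) ((e \<circ> t) n))) \<longlonglongrightarrow> dist \<beta>' \<beta>"
      by (intro tendsto_dist)
    then have "5 / 2 * \<epsilon> \<le> dist \<beta>' \<beta>"
      by (rule LIMSEQ_le_const) (use ce in auto)
    moreover have "(\<lambda>n. dist (\<phi> ((f \<circ> r') n) \<xi>) (\<phi> ((h \<circ> t) n) \<xi>)) \<longlonglongrightarrow> dist \<beta>' \<beta>"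
      by (intro tendsto_dist nonconical_tendsto[OF nc r'(2)] nonconical_tendsto[OF nc ht])
    then have "dist \<beta>' \<beta> \<le> \<epsilon>"
    proof (rule LIMSEQ_le_const2)
      show "\<exists>N. \<forall>n\<ge>N. dist (\<phi> ((f \<circ> r') n) \<xi>) (\<phi> ((h \<circ> t) n) \<xi>) \<le> \<epsilon>"
        unfolding ft using uniformly_closeD[OF uniformly_close_sym[OF g\<xi>] hG] by auto
    qed
    ultimately show False using \<open>0 < \<epsilon>\<close> by simp
  qed
qed

section \<open>Density\<close>

abbreviation limits :: "'m set"
  where "limits \<equiv> limit_set \<phi> (carrier G)"

lemma limits_iff: "b \<in> limits \<longleftrightarrow> (\<exists>g a. conv g a b)"
  by (simp add: limit_set_def)

lemma limits_act: "\<lbrakk>b \<in> limits; k \<in> carrier G\<rbrakk> \<Longrightarrow> \<phi> k b \<in> limits"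
  using conv_mult_left unfolding limits_iff by blast

lemma conical_limits: "conical G \<phi> \<xi> \<Longrightarrow> \<xi> \<in> limits"
  using conv_inv unfolding limits_iff conical_def by blast

text \<open>A diagonal choice from convergence sequences towards the \<open>x n\<close>, along a
  subsequence with converging repelling points, is a convergence sequence towards \<open>l\<close>.
  Closedness later makes the set \<open>K\<close> for cocompactness compact.\<close>

lemma closed_limits: "closed limits"
  unfolding closed_sequential_limits
proof (intro allI impI)
  fix x l assume "(\<forall>n. x n \<in> limits) \<and> x \<longlonglongrightarrow> l"
  then have x: "\<And>n. x n \<in> limits" "x \<longlonglongrightarrow> l" by auto
  then obtain g a where g: "\<And>n. conv (g n) (a n) (x n)" unfolding limits_iff by metis
  obtain r \<alpha> where r: "strict_mono r" "(a \<circ> r) \<longlonglongrightarrow> \<alpha>" by (rule compact_subsequence)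
  define S where "S = (\<lambda>m. {\<gamma> \<in> carrier G.
    \<forall>z. 1 / real (Suc m) \<le> dist z (a (r m)) \<longrightarrow> dist (\<phi> \<gamma> z) (x (r m)) < 1 / real (Suc m)})"
  have "infinite (S m)" for m
  proof -
    have "0 < 1 / real (Suc m)" by simp
    from conv_eventually[OF g[of "r m"] this this]
    have "\<forall>\<^sub>F n in sequentially. g (r m) n \<in> S m"
      by eventually_elim (simp add: S_def conv_carrier[OF g])
    then obtain N where N: "\<And>n. N \<le> n \<Longrightarrow> g (r m) n \<in> S m"
      unfolding eventually_sequentially by blast
    have "inj (g (r m))" using g[of "r m"] unfolding conv_iff by blast
    then have "inj_on (g (r m)) {N..}" by (rule inj_on_subset) simp
    then have "infinite (g (r m) ` {N..})" by (simp add: finite_image_iff infinite_Ici)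
    moreover have "g (r m) ` {N..} \<subseteq> S m" using N by auto
    ultimately show ?thesis using finite_subset by blast
  qed
  then obtain \<gamma> where \<gamma>: "inj \<gamma>" "\<And>m. \<gamma> m \<in> S m" using exists_inj_selection by blast
  have "conv \<gamma> \<alpha> l"
    unfolding conv_iff
  proof (intro conjI allI impI)
    show "inj \<gamma>" "range \<gamma> \<subseteq> carrier G" using \<gamma> unfolding S_def by auto
    fix \<delta> \<kappa> :: real assume "0 < \<delta>" "0 < \<kappa>"
    have inv0: "(\<lambda>n. 1 / real (Suc n)) \<longlonglongrightarrow> 0"
      using LIMSEQ_Suc[OF lim_const_over_n[of 1]] by simp
    have "\<forall>\<^sub>F n in sequentially. 1 / real (Suc n) < \<delta> / 2"
      "\<forall>\<^sub>F n in sequentially. 1 / real (Suc n) < \<kappa> / 2"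
      using order_tendstoD(2)[OF inv0, of "\<delta> / 2"] order_tendstoD(2)[OF inv0, of "\<kappa> / 2"]
        \<open>0 < \<delta>\<close> \<open>0 < \<kappa>\<close> by simp_all
    moreover have "\<forall>\<^sub>F n in sequentially. dist ((a \<circ> r) n) \<alpha> < \<delta> / 2"
      "\<forall>\<^sub>F n in sequentially. dist ((x \<circ> r) n) l < \<kappa> / 2"
      by (rule tendstoD[OF r(2)], use \<open>0 < \<delta>\<close> in simp)
        (rule tendstoD[OF LIMSEQ_subseq_LIMSEQ[OF x(2) r(1)]], use \<open>0 < \<kappa>\<close> in simp)
    ultimately show "\<forall>\<^sub>F n in sequentially. \<forall>z. \<delta> \<le> dist z \<alpha> \<longrightarrow> dist (\<phi> (\<gamma> n) z) l < \<kappa>"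
    proof eventually_elim
      case (elim n)
      show ?case
      proof (intro allI impI)
        fix z assume "\<delta> \<le> dist z \<alpha>"
        then have "1 / real (Suc n) \<le> dist z (a (r n))"
          using elim(1,3) dist_triangle[of z \<alpha> "a (r n)"] by simp
        then have "dist (\<phi> (\<gamma> n) z) (x (r n)) < 1 / real (Suc n)"
          using \<gamma>(2)[of n] unfolding S_def by blast
        then show "dist (\<phi> (\<gamma> n) z) l < \<kappa>"
          using elim(2,4) dist_triangle[of "\<phi> (\<gamma> n) z" l "x (r n)"] by simp
      qed
    qed
  qed
  then show "l \<in> limits" unfolding limits_iff by blast
qed

text \<open>A convergence sequence that attracts to \<open>\<xi>\<close> and repels from another
  point contains an element with a conical fixed point near \<open>\<xi>\<close>.\<close>

lemma conical_near:
  assumes nc: "\<not> conical G \<phi> \<xi>" and "\<xi> \<in> limits" and k: "k \<in> carrier G" "\<phi> k \<xi> \<noteq> \<xi>" and "0 < \<delta>"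
  obtains c where "conical G \<phi> c" "dist c \<xi> < \<delta>"
proof -
  obtain g a where g: "conv g a \<xi>" using \<open>\<xi> \<in> limits\<close> unfolding limits_iff by blast
  obtain g' a' where g': "conv g' a' \<xi>" "a' \<noteq> \<xi>"
  proof (cases "a = \<xi>")
    case True
    \<comment> \<open>If \<open>\<xi>\<close> is also repelling, the inverses of
      \<open>k \<otimes> g n\<close> attract to \<open>\<xi>\<close> and repel from
      \<open>\<phi> k \<xi>\<close>.\<close>
    with conv_inv[OF conv_mult_left[OF g k(1)]] k(2) that show ?thesis by blast
  qed (use g that in blast)
  obtain z where "z \<noteq> a'" "z \<noteq> \<xi>" by (rule third_point[OF nc g'])
  then show ?thesis using conv_loxodromic[OF g' _ _ \<open>0 < \<delta>\<close>] that by metis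
qed

text \<open>The \<open>Q\<close> of the overview. It is closed under inverses, but products of two
  members are only controlled with \<open>2 * e\<close>.\<close>

definition coarse_stabilizer :: "real \<Rightarrow> 'm \<Rightarrow> 'g set"
  where "coarse_stabilizer e \<xi> = {q \<in> carrier G. uniformly_close e \<xi> (\<phi> q \<xi>)}"

text \<open>If it were finite, the net would leave finitely many elements to test. By continuity
  none of them separates \<open>\<xi>\<close> from a conical point very near it, so that point would
  be uniformly close.\<close>

lemma infinite_coarse_stabilizer:
  assumes nc: "\<not> conical G \<phi> \<xi>" and \<xi>: "\<xi> \<in> limits" and "0 < \<epsilon>"
    and far: "\<And>c. conical G \<phi> c \<Longrightarrow> \<not> uniformly_close \<epsilon> \<xi> c"
  shows "infinite (coarse_stabilizer \<epsilon> \<xi>)"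
proof (cases "\<forall>k\<in>carrier G. \<phi> k \<xi> = \<xi>")
  \<comment> \<open>A global fixed point is treated apart, since \<open>conical_near\<close> needs
    an element moving \<open>\<xi>\<close>.\<close>
  case True
  then have "coarse_stabilizer \<epsilon> \<xi> = carrier G"
    using uniformly_close_refl[of \<epsilon> \<xi>] \<open>0 < \<epsilon>\<close> by (auto simp: coarse_stabilizer_def)
  moreover obtain g a where "conv g a \<xi>" using \<xi> unfolding limits_iff by blast
  then have "infinite (carrier G)"
    unfolding conv_iff using finite_subset range_inj_infinite by blast
  ultimately show ?thesis by simp
next
  case False
  then obtain k where k: "k \<in> carrier G" "\<phi> k \<xi> \<noteq> \<xi>" by blast
  show ?thesis
  proof
    assume fin: "finite (coarse_stabilizer \<epsilon> \<xi>)"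
    obtain T where T: "finite T" "T \<subseteq> carrier G"
      "\<forall>\<eta>. \<forall>g\<in>carrier G. \<epsilon> / 4 \<le> dist (\<phi> g \<xi>) (\<phi> g \<eta>) \<longrightarrow>
        (\<exists>f\<in>carrier G. \<exists>k\<in>T. \<epsilon> / 4 \<le> dist (\<phi> f \<xi>) (\<phi> f \<eta>) \<and> uniformly_close \<epsilon> (\<phi> k \<xi>) (\<phi> f \<xi>))"
      by (rule finite_orbit_net[OF nc \<open>0 < \<epsilon>\<close>])
    \<comment> \<open>If \<open>\<phi> f \<xi>\<close> is close to \<open>\<phi> k \<xi>\<close>,
      then \<open>inv k \<otimes> f\<close> lies in the coarse stabilizer, so \<open>f\<close> lies
      in \<open>E\<close>.\<close>
    define E where "E = (\<lambda>(k, q). k \<otimes> q) ` (T \<times> coarse_stabilizer \<epsilon> \<xi>)"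
    have "finite E" unfolding E_def using T(1) fin by simp
    have E: "f \<in> E" if f: "f \<in> carrier G" "k \<in> T" "uniformly_close \<epsilon> (\<phi> k \<xi>) (\<phi> f \<xi>)" for f k
    proof -
      have kG: "k \<in> carrier G" using f(2) T(2) by blast
      have "uniformly_close \<epsilon> \<xi> (\<phi> (inv k \<otimes> f) \<xi>)"
        using uniformly_close_act[OF f(3), of "inv k"] f(1) kG by (simp add: act_mult)
      then have "inv k \<otimes> f \<in> coarse_stabilizer \<epsilon> \<xi>" unfolding coarse_stabilizer_def using f(1) kG by simp
      moreover have "f = k \<otimes> (inv k \<otimes> f)" using f(1) kG by (simp add: m_assoc[symmetric])
      ultimately show ?thesis
        unfolding E_def using f(2) by (intro image_eqI[of _ _ "(k, inv k \<otimes> f)"]) auto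
    qed
    have EG: "E \<subseteq> carrier G" unfolding E_def coarse_stabilizer_def using T(2) by auto
    have "\<forall>\<^sub>F \<eta> in at \<xi>. \<forall>f\<in>E. dist (\<phi> f \<eta>) (\<phi> f \<xi>) < \<epsilon> / 4"
    proof (intro eventually_ball_finite \<open>finite E\<close> ballI)
      show "\<forall>\<^sub>F \<eta> in at \<xi>. dist (\<phi> f \<eta>) (\<phi> f \<xi>) < \<epsilon> / 4" if "f \<in> E" for f
        using isCont_act[of f \<xi>] EG that \<open>0 < \<epsilon>\<close> unfolding isCont_def by (intro tendstoD) auto
    qed
    then obtain \<delta> where \<delta>: "0 < \<delta>"
      "\<And>\<eta>. \<lbrakk>\<eta> \<noteq> \<xi>; dist \<eta> \<xi> < \<delta>\<rbrakk> \<Longrightarrow> \<forall>f\<in>E. dist (\<phi> f \<eta>) (\<phi> f \<xi>) < \<epsilon> / 4"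
      unfolding eventually_at by blast
    obtain c where c: "conical G \<phi> c" "dist c \<xi> < \<delta>"
      by (rule conical_near[OF nc \<xi> k \<delta>(1)])
    have "c \<noteq> \<xi>" using c(1) nc by blast
    have "uniformly_close \<epsilon> \<xi> c"
      unfolding uniformly_close_def
    proof (intro ballI, rule ccontr)
      fix g assume g: "g \<in> carrier G" "\<not> dist (\<phi> g \<xi>) (\<phi> g c) \<le> \<epsilon>"
      then have "\<epsilon> / 4 \<le> dist (\<phi> g \<xi>) (\<phi> g c)" using \<open>0 < \<epsilon>\<close> by simp
      then obtain f where "f \<in> E" "\<epsilon> / 4 \<le> dist (\<phi> f \<xi>) (\<phi> f c)" using T(3) g(1) E by blast
      with \<delta>(2)[OF \<open>c \<noteq> \<xi>\<close> c(2)] show False by (auto simp: dist_commute)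
    qed
    with far[OF c(1)] show False by blast
  qed
qed

text \<open>Each sequence has equal attracting and repelling points, by
  \<open>conical_uniformly_close\<close>. If \<open>b\<close> and \<open>b'\<close> differed, the
  products \<open>q n \<otimes> q' n\<close> would contract the complement of \<open>b'\<close> to
  \<open>b\<close> while moving \<open>\<xi>\<close> by at most \<open>2 * \<epsilon>\<close>. This
  gives a conical point within \<open>3 * (2 * \<epsilon>)\<close>.\<close>

lemma coarse_stabilizer_attractor_unique:
  assumes nc: "\<not> conical G \<phi> \<xi>" and "0 < \<epsilon>"
    and far: "\<And>c. conical G \<phi> c \<Longrightarrow> \<not> uniformly_close (6 * \<epsilon>) \<xi> c"
    and q: "conv q a b" "\<And>n. q n \<in> coarse_stabilizer \<epsilon> \<xi>"
    and q': "conv q' a' b'" "\<And>n. q' n \<in> coarse_stabilizer \<epsilon> \<xi>"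
  shows "b = b'"
proof (rule ccontr)
  assume "b \<noteq> b'"
  have close: "uniformly_close \<epsilon> \<xi> (\<phi> (q n) \<xi>)" "uniformly_close \<epsilon> \<xi> (\<phi> (q' n) \<xi>)" for n
    using q(2) q'(2) by (auto simp: coarse_stabilizer_def)
  have qG: "q n \<in> carrier G" "q' n \<in> carrier G" for n
    using q(1) q'(1) conv_carrier by auto
  have three: "3 * \<epsilon> \<le> 6 * \<epsilon>" using \<open>0 < \<epsilon>\<close> by simp
  have "a = b"
    using conical_uniformly_close[OF nc \<open>0 < \<epsilon>\<close> q(1) _ close(1)] far uniformly_close_mono[OF _ three]
    by metis
  have "a' = b'"
    using conical_uniformly_close[OF nc \<open>0 < \<epsilon>\<close> q'(1) _ close(2)] far uniformly_close_mono[OF _ three]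
    by metis
  define p where "p = (\<lambda>n. q n \<otimes> q' n)"
  have pG: "p n \<in> carrier G" for n unfolding p_def using qG by simp
  have contr: "\<forall>\<^sub>F n in sequentially. \<forall>z. \<delta> \<le> dist z b' \<longrightarrow> dist (\<phi> (p n) z) b < \<kappa>"
    if "0 < \<delta>" "0 < \<kappa>" for \<delta> \<kappa>
  proof -
    have pos: "0 < dist b b' / 2" using \<open>b \<noteq> b'\<close> by simp
    show ?thesis
      using conv_eventually[OF q(1) pos \<open>0 < \<kappa>\<close>] conv_eventually[OF q'(1) \<open>0 < \<delta>\<close> pos]
    proof eventually_elim
      case (elim n)
      show ?case
      proof (intro allI impI)
        fix z assume "\<delta> \<le> dist z b'"
        then have "dist (\<phi> (q' n) z) b' < dist b b' / 2" using elim(2) \<open>a' = b'\<close> by blast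
        then have "dist b b' / 2 \<le> dist (\<phi> (q' n) z) b"
          using dist_triangle3[of b b' "\<phi> (q' n) z"] by simp
        then show "dist (\<phi> (p n) z) b < \<kappa>"
          using elim(1) \<open>a = b\<close> qG by (simp add: p_def act_mult)
      qed
    qed
  qed
  obtain z where z: "z \<noteq> b" "z \<noteq> b'" by (rule third_point[OF nc q(1) \<open>b \<noteq> b'\<close>])
  obtain r where r: "strict_mono (r :: nat \<Rightarrow> nat)" "(\<forall>n. p (r n) = p (r 0)) \<or> inj (p \<circ> r)"
    by (rule subseq_constant_or_inj[of p])
  have pr: "\<forall>\<^sub>F n in sequentially. \<forall>z. \<delta> \<le> dist z b' \<longrightarrow> dist (\<phi> ((p \<circ> r) n) z) b < \<kappa>"
    if "0 < \<delta>" "0 < \<kappa>" for \<delta> \<kappa>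
    using eventually_subseq[OF r(1) contr[OF that]] by simp
  from r(2) show False
  proof
    \<comment> \<open>The products need not be distinct. A single element would have to send both
      \<open>b\<close> and \<open>z\<close> to \<open>b\<close>, against injectivity.\<close>
    assume const: "\<forall>n. p (r n) = p (r 0)"
    have "\<phi> (p (r 0)) x = b" if "x \<noteq> b'" for x
    proof (rule ccontr)
      assume "\<phi> (p (r 0)) x \<noteq> b"
      then have "\<forall>\<^sub>F n in sequentially. \<forall>z. dist x b' \<le> dist z b' \<longrightarrow>
          dist (\<phi> ((p \<circ> r) n) z) b < dist (\<phi> (p (r 0)) x) b"
        using that by (intro pr) auto
      then obtain n where "dist (\<phi> ((p \<circ> r) n) x) b < dist (\<phi> (p (r 0)) x) b"
        using eventually_happens'[OF sequentially_bot] by blast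
      moreover have "(p \<circ> r) n = p (r 0)" using const by simp
      ultimately show False by simp
    qed
    from this[OF \<open>b \<noteq> b'\<close>] this[OF z(2)] z(1) show False using pG by (metis act_eq_iff)
  next
    assume "inj (p \<circ> r)"
    then have "conv (p \<circ> r) b' b" unfolding conv_iff using pG pr by auto
    moreover have "uniformly_close (2 * \<epsilon>) \<xi> (\<phi> ((p \<circ> r) n) \<xi>)" for n
      using uniformly_close_trans[OF close(1) uniformly_close_act[OF close(2) qG(1)], of "r n" "r n"] qG
      by (simp add: p_def act_mult)
    ultimately obtain c where "conical G \<phi> c" "uniformly_close (3 * (2 * \<epsilon>)) \<xi> c"
      using conical_uniformly_close[OF nc, of "2 * \<epsilon>" "p \<circ> r" b' b] \<open>0 < \<epsilon>\<close> \<open>b \<noteq> b'\<close>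
      by (metis mult_pos_pos zero_less_numeral)
    with far show False by simp
  qed
qed

text \<open>An element moving \<open>\<xi>\<close> by at most \<open>\<epsilon>\<close> must fix it,
  so the infinite coarse stabilizer lies in the stabilizer. The finite net then gives
  cocompactness.\<close>

lemma isolated_bounded_parabolic:
  assumes nc: "\<not> conical G \<phi> \<xi>" and \<xi>: "\<xi> \<in> limits" and "0 < \<epsilon>"
    and iso: "\<And>\<eta>. \<lbrakk>\<eta> \<in> limits; uniformly_close \<epsilon> \<xi> \<eta>\<rbrakk> \<Longrightarrow> \<eta> = \<xi>"
  shows "bounded_parabolic G \<phi> \<xi>"
proof -
  define P where "P = stabilizer G \<phi> \<xi>"
  have P: "p \<in> P \<longleftrightarrow> p \<in> carrier G \<and> \<phi> p \<xi> = \<xi>" for p by (simp add: P_def stabilizer_def)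
  have "\<not> uniformly_close \<epsilon> \<xi> c" if "conical G \<phi> c" for c
    using iso[OF conical_limits[OF that]] that nc by blast
  then have "infinite (coarse_stabilizer \<epsilon> \<xi>)"
    by (rule infinite_coarse_stabilizer[OF nc \<xi> \<open>0 < \<epsilon>\<close>])
  moreover have "coarse_stabilizer \<epsilon> \<xi> \<subseteq> P"
    using iso limits_act[OF \<xi>] by (auto simp: coarse_stabilizer_def P)
  ultimately have inf: "infinite P" using finite_subset by blast
  have sub_P: "P \<subseteq> carrier G" using P by blast
  have convP: "convergence_sequence \<phi> P g a b \<longleftrightarrow> conv g a b \<and> range g \<subseteq> P" for g a b
    using sub_P unfolding conv_iff by auto
  have attr: "b = \<xi>" if "conv g a b" "range g \<subseteq> P" for g a b
  proof -
    have "(\<lambda>n. \<phi> (g n) \<xi>) = (\<lambda>n. \<xi>)" using that(2) P by auto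
    then show ?thesis using nonconical_tendsto[OF nc that(1)] by (simp add: LIMSEQ_const_iff)
  qed
  obtain s a b where s: "conv s a b" "\<And>n. s n \<in> P"
    using subconvergence_infinite[OF inf sub_P] by blast
  have "limit_set \<phi> P = {\<xi>}"
    unfolding limit_set_def convP using attr s by blast
  then have par: "parabolic G \<phi> \<xi>" unfolding parabolic_def using inf P_def by simp
  obtain T where T: "finite T" "T \<subseteq> carrier G"
    "\<forall>\<eta>. \<forall>g\<in>carrier G. \<epsilon> / 4 \<le> dist (\<phi> g \<xi>) (\<phi> g \<eta>) \<longrightarrow>
      (\<exists>f\<in>carrier G. \<exists>k\<in>T. \<epsilon> / 4 \<le> dist (\<phi> f \<xi>) (\<phi> f \<eta>) \<and> uniformly_close \<epsilon> (\<phi> k \<xi>) (\<phi> f \<xi>))"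
    by (rule finite_orbit_net[OF nc \<open>0 < \<epsilon>\<close>])
  define K where "K = (\<Union>k\<in>T. limits \<inter> {z. \<epsilon> / 4 \<le> dist (\<phi> k \<xi>) (\<phi> k z)})"
  have "closed {z. \<epsilon> / 4 \<le> dist (\<phi> k \<xi>) (\<phi> k z)}" if "k \<in> T" for k
    using continuous_act[of k] that T(2) by (intro closed_Collect_le continuous_intros) auto
  then have "closed K"
    unfolding K_def using T(1) closed_limits by (intro closed_UN closed_Int) auto
  then have "compact K" using compact_Int_closed[OF compact_space] by simp
  moreover have "K \<subseteq> limits - {\<xi>}" unfolding K_def using \<open>0 < \<epsilon>\<close> by auto
  moreover have "(\<Union>h\<in>P. \<phi> h ` K) = limits - {\<xi>}"
  proof
    show "(\<Union>h\<in>P. \<phi> h ` K) \<subseteq> limits - {\<xi>}"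
    proof (intro UN_least image_subsetI)
      fix h x assume h: "h \<in> P" "x \<in> K"
      then have "\<phi> h x \<noteq> \<phi> h \<xi>" using P \<open>K \<subseteq> limits - {\<xi>}\<close> by auto
      then show "\<phi> h x \<in> limits - {\<xi>}"
        using h P limits_act \<open>K \<subseteq> limits - {\<xi>}\<close> by auto
    qed
    show "limits - {\<xi>} \<subseteq> (\<Union>h\<in>P. \<phi> h ` K)"
    proof
      fix \<eta> assume \<eta>: "\<eta> \<in> limits - {\<xi>}"
      then have "\<not> uniformly_close \<epsilon> \<xi> \<eta>" using iso by blast
      then obtain g where "g \<in> carrier G" "\<epsilon> / 4 \<le> dist (\<phi> g \<xi>) (\<phi> g \<eta>)"
        unfolding uniformly_close_def using \<open>0 < \<epsilon>\<close> by force
      then obtain f k where f: "f \<in> carrier G" and k: "k \<in> T"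
        and sep: "\<epsilon> / 4 \<le> dist (\<phi> f \<xi>) (\<phi> f \<eta>)" and cl: "uniformly_close \<epsilon> (\<phi> k \<xi>) (\<phi> f \<xi>)"
        using T(3) by blast
      have kG: "k \<in> carrier G" using k T(2) by blast
      \<comment> \<open>By isolation \<open>p\<close> fixes \<open>\<xi>\<close>; it carries
        \<open>\<eta>\<close> into \<open>K\<close>, because \<open>k\<close> separates
        \<open>\<xi>\<close> from \<open>\<phi> p \<eta>\<close> just as \<open>f\<close> separates
        \<open>\<xi>\<close> from \<open>\<eta>\<close>.\<close>
      define p where "p = inv k \<otimes> f"
      have p: "p \<in> carrier G" "\<And>x. \<phi> p x = \<phi> (inv k) (\<phi> f x)"
        unfolding p_def using f kG by (auto simp: act_mult)
      have "uniformly_close \<epsilon> \<xi> (\<phi> p \<xi>)"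
        using uniformly_close_act[OF cl, of "inv k"] kG by (simp add: p)
      then have "\<phi> p \<xi> = \<xi>" using iso limits_act[OF \<xi> p(1)] by blast
      then have "p \<in> P" using p(1) P by blast
      have kp: "\<phi> k (\<phi> p x) = \<phi> f x" for x using kG by (simp add: p(2))
      have "\<epsilon> / 4 \<le> dist (\<phi> k \<xi>) (\<phi> k (\<phi> p \<eta>))"
        using sep kp[of \<xi>] kp[of \<eta>] \<open>\<phi> p \<xi> = \<xi>\<close> by simp
      then have "\<phi> p \<eta> \<in> K" unfolding K_def using k \<eta> limits_act p(1) by blast
      moreover have "inv p \<in> P" using p(1) \<open>\<phi> p \<xi> = \<xi>\<close> P by (metis act_inv_left inv_closed)
      moreover have "\<eta> = \<phi> (inv p) (\<phi> p \<eta>)" using p(1) by simp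
      ultimately show "\<eta> \<in> (\<Union>h\<in>P. \<phi> h ` K)" by blast
    qed
  qed
  ultimately show ?thesis
    unfolding bounded_parabolic_def cocompact_on_def using par P_def by blast
qed

lemma conical_or_bounded_parabolic_uniformly_close:
  assumes \<xi>: "\<xi> \<in> limits" and "0 < \<epsilon>"
  shows "\<exists>x\<in>limits. (conical G \<phi> x \<or> bounded_parabolic G \<phi> x) \<and> uniformly_close \<epsilon> \<xi> x"
proof (rule ccontr)
  assume none': "\<not> ?thesis"
  have none: "\<not> conical G \<phi> x" "\<not> bounded_parabolic G \<phi> x"
    if "x \<in> limits" "uniformly_close \<epsilon> \<xi> x" for x
    using none' that by blast+
  then have far: "\<not> uniformly_close \<epsilon> \<xi> c" if "conical G \<phi> c" for c
    using that conical_limits by blast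
  have \<xi>\<xi>: "uniformly_close e \<xi> \<xi>" if "0 < e" for e using that by (simp add: uniformly_close_refl)
  have nc: "\<not> conical G \<phi> \<xi>" using none(1) \<xi> \<xi>\<xi> \<open>0 < \<epsilon>\<close> by blast
  \<comment> \<open>Small enough that \<open>6 * \<delta> \<le> \<epsilon>\<close>, as uniqueness of
    the attracting point requires.\<close>
  define \<delta> where "\<delta> = \<epsilon> / 12"
  have "0 < \<delta>" using \<open>0 < \<epsilon>\<close> by (simp add: \<delta>_def)
  \<comment> \<open>A sequence from the finer coarse stabilizer of \<open>\<eta>\<close> also lies
    in that of \<open>\<xi>\<close> at scale \<open>\<delta>\<close>, so one attracting point serves
    all \<open>\<eta>\<close> near \<open>\<xi>\<close>, while \<open>e\<close> can be made
    arbitrarily small.\<close>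
  have seq: "\<exists>s a b. conv s a b \<and> (\<forall>n. s n \<in> coarse_stabilizer \<delta> \<xi>) \<and> uniformly_close e \<eta> b"
    if \<eta>: "\<eta> \<in> limits" "uniformly_close (\<delta> / 4) \<xi> \<eta>" and e: "0 < e" "e \<le> \<delta> / 2" for \<eta> e
  proof -
    have "uniformly_close \<epsilon> \<xi> \<eta>"
      using \<eta>(2) by (rule uniformly_close_mono) (use \<open>0 < \<epsilon>\<close> in \<open>simp add: \<delta>_def\<close>)
    then have nc\<eta>: "\<not> conical G \<phi> \<eta>" using none(1) \<eta>(1) by blast
    have "\<not> uniformly_close e \<eta> c" if "conical G \<phi> c" for c
    proof
      assume "uniformly_close e \<eta> c"
      with \<eta>(2) have "uniformly_close (\<delta> / 4 + e) \<xi> c" by (rule uniformly_close_trans)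
      then have "uniformly_close \<epsilon> \<xi> c"
        by (rule uniformly_close_mono) (use e \<open>0 < \<epsilon>\<close> in \<open>simp add: \<delta>_def\<close>)
      with far[OF that] show False by blast
    qed
    then have "infinite (coarse_stabilizer e \<eta>)"
      by (rule infinite_coarse_stabilizer[OF nc\<eta> \<eta>(1) e(1)])
    moreover have "coarse_stabilizer e \<eta> \<subseteq> carrier G" by (auto simp: coarse_stabilizer_def)
    ultimately obtain s a b where s: "conv s a b" "\<And>n. s n \<in> coarse_stabilizer e \<eta>"
      using subconvergence_infinite by blast
    have sG: "s n \<in> carrier G" and s\<eta>: "uniformly_close e \<eta> (\<phi> (s n) \<eta>)" for n
      using s(2) by (auto simp: coarse_stabilizer_def)
    have "uniformly_close \<delta> \<xi> (\<phi> (s n) \<xi>)" for n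
    proof (rule uniformly_close_mono)
      show "uniformly_close (\<delta> / 4 + e + \<delta> / 4) \<xi> (\<phi> (s n) \<xi>)"
        by (rule uniformly_close_trans[OF uniformly_close_trans[OF \<eta>(2) s\<eta>[of n]]
              uniformly_close_act[OF uniformly_close_sym[OF \<eta>(2)] sG[of n]]])
    qed (use e in simp)
    moreover have "uniformly_close e \<eta> b"
      by (rule uniformly_close_lim[OF nonconical_tendsto[OF nc\<eta> s(1)] s\<eta>])
    ultimately show ?thesis
      using s(1) sG by (intro exI[of _ s] exI[of _ a] exI[of _ b]) (simp add: coarse_stabilizer_def)
  qed
  obtain s\<^sub>0 a\<^sub>0 p where s\<^sub>0: "conv s\<^sub>0 a\<^sub>0 p" "\<And>n. s\<^sub>0 n \<in> coarse_stabilizer \<delta> \<xi>"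
    using seq[OF \<xi> \<xi>\<xi>, of "\<delta> / 2"] \<open>0 < \<delta>\<close> by auto
  have far6: "\<not> uniformly_close (6 * \<delta>) \<xi> c" if "conical G \<phi> c" for c
    using far[OF that] uniformly_close_mono[of "6 * \<delta>" \<xi> c \<epsilon>] \<open>0 < \<epsilon>\<close> by (auto simp: \<delta>_def)
  have eq_p: "\<eta> = p" if \<eta>: "\<eta> \<in> limits" "uniformly_close (\<delta> / 4) \<xi> \<eta>" for \<eta>
  proof (rule ccontr)
    assume "\<eta> \<noteq> p"
    define e where "e = min (\<delta> / 2) (dist \<eta> p / 2)"
    have e: "0 < e" "e \<le> \<delta> / 2" "e < dist \<eta> p"
      using \<open>\<eta> \<noteq> p\<close> \<open>0 < \<delta>\<close> by (auto simp: e_def min_def)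
    then obtain s a b where s: "conv s a b" "\<And>n. s n \<in> coarse_stabilizer \<delta> \<xi>" "uniformly_close e \<eta> b"
      using seq[OF \<eta> e(1,2)] by blast
    have "b = p"
      by (rule coarse_stabilizer_attractor_unique[OF nc \<open>0 < \<delta>\<close> far6 s(1,2) s\<^sub>0])
    with uniformly_close_dist[OF s(3)] e(3) show False by simp
  qed
  have "bounded_parabolic G \<phi> \<xi>"
  proof (rule isolated_bounded_parabolic[OF nc \<xi>])
    show "0 < \<delta> / 4" using \<open>0 < \<delta>\<close> by simp
    show "\<eta> = \<xi>" if "\<eta> \<in> limits" "uniformly_close (\<delta> / 4) \<xi> \<eta>" for \<eta>
      using eq_p[OF that] eq_p[OF \<xi> \<xi>\<xi>] \<open>0 < \<delta>\<close> by simp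
  qed
  with none(2)[OF \<xi> \<xi>\<xi>[OF \<open>0 < \<epsilon>\<close>]] show False by blast
qed

end

section \<open>Transfer to the orbit uniform metric of \<open>d\<close>\<close>

theorem theorem1p6:
  fixes G :: "('g, 'r) monoid_scheme"
    and \<phi> :: "'g \<Rightarrow> 'm::metric_space \<Rightarrow> 'm"
    and d :: "'m \<Rightarrow> 'm \<Rightarrow> real"
  assumes "convergence_action G \<phi>"
    and "compatible_metric d"
  shows "Metric_space.mtopology (limit_set \<phi> (carrier G)) (orbit_uniform_metric G \<phi> d)
      closure_of {\<xi>. conical G \<phi> \<xi> \<or> bounded_parabolic G \<phi> \<xi>}
    = limit_set \<phi> (carrier G)"
proof -
  interpret convergence_action G \<phi> by (rule assms(1))
  interpret du: Metric_space limits "orbit_uniform_metric G \<phi> d"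
    by (rule Metric_space_orbit_uniform_metric[OF assms(2)])
  have "\<exists>x\<in>{\<xi>. conical G \<phi> \<xi> \<or> bounded_parabolic G \<phi> \<xi>}. x \<in> du.mball \<xi> r"
    if \<xi>: "\<xi> \<in> limits" and r: "0 < r" for \<xi> r
  proof -
    \<comment> \<open>The halves make room for strictness: the supremum is only bounded by
      \<open>r / 2\<close>, and \<open>uniformly_close\<close> is not strict.\<close>
    have "0 < r / 2" using r by simp
    then obtain \<delta> where \<delta>: "0 < \<delta>" "\<And>x y. dist x y < \<delta> \<Longrightarrow> d x y < r / 2"
      using compatible_metric_uniformly_continuous[OF compact_space assms(2)] by metis
    have "0 < \<delta> / 2" using \<delta>(1) by simp
    then obtain x where x: "x \<in> limits" "conical G \<phi> x \<or> bounded_parabolic G \<phi> x"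
      "uniformly_close (\<delta> / 2) \<xi> x"
      using conical_or_bounded_parabolic_uniformly_close[OF \<xi>] by blast
    have "orbit_uniform_metric G \<phi> d \<xi> x \<le> r / 2"
      unfolding orbit_uniform_metric_def
    proof (rule cSUP_least)
      show "d (\<phi> g \<xi>) (\<phi> g x) \<le> r / 2" if "g \<in> carrier G" for g
        using \<delta>(2)[of "\<phi> g \<xi>" "\<phi> g x"] uniformly_closeD[OF x(3) that] \<delta>(1) by simp
    qed (use one_closed in blast)
    with x \<xi> r show ?thesis by auto
  qed
  then show ?thesis unfolding du.metric_closure_of by auto
qed

end
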